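(* Let $\chi$ be a non-trivial Dirichlet character modulo $q$ (any $q$), and let $\eta(s)$ be the entire function equal to $\sum_{n\ge1}(-1)^{n-1}n^{-s}$ for $\Re s>0$. For $\Re s_0>-1$ and $s\in\mathbb{C}$, $$L(s+s_0,\chi)=\frac{1}{\Gamma(s_0+1)}\sum_{m=0}^\infty(m+1)\left(\int_0^\infty\frac{x^{s_0}e^{-x(m+1)}}{(1+e^{-x})^{m+2}}\,dx\right)\sum_{j=0}^m\frac{\chi(j+1)\binom{m}{j}}{(j+1)^s},$$ and for all $s_0,s\in\mathbb{C}$, $$L(s+s_0,\chi)=\sum_{m=0}^\infty\frac{(-1)^m}{m!}\sum_{l=1}^{m+1}s(m+1,l)\,\eta(s_0+1-l)\sum_{j=0}^m\frac{\chi(j+1)\binom{m}{j}}{(j+1)^s}.$$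
   Context: $L(s,\chi)$ is the Dirichlet $L$-function, analytically continued to $\mathbb{C}$. $s(m+1,l)$ are the (signed) Stirling numbers of the first kind, defined by $x(x-1)\cdots(x-m)=\sum_l s(m+1,l)x^l$. *)

theory Defs
  imports "HOL-Analysis.Analysis" "HOL-Combinatorics.Stirling"
begin

definition dirichlet_character :: "nat \<Rightarrow> (nat \<Rightarrow> complex) \<Rightarrow> bool" where
  "dirichlet_character q chi \<longleftrightarrow> q \<ge> 1 \<and> chi 1 = 1 \<and>
     (\<forall>m n. chi (m * n) = chi m * chi n) \<and>
     (\<forall>n. chi (n + q) = chi n) \<and>
     (\<forall>n. chi n = 0 \<longleftrightarrow> \<not> coprime n q)"

definition nontrivial_character :: "nat \<Rightarrow> (nat \<Rightarrow> complex) \<Rightarrow> bool" where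
  "nontrivial_character q chi \<longleftrightarrow> dirichlet_character q chi \<and>
     (\<exists>n. coprime n q \<and> chi n \<noteq> 1)"

definition dirichlet_L :: "(nat \<Rightarrow> complex) \<Rightarrow> complex \<Rightarrow> complex" where
  "dirichlet_L chi = (THE f. f holomorphic_on UNIV \<and>
     (\<forall>s. 1 < Re s \<longrightarrow> (\<lambda>n. chi (Suc n) / of_nat (Suc n) powr s) sums f s))"

definition dirichlet_eta :: "complex \<Rightarrow> complex" where
  "dirichlet_eta = (THE f. f holomorphic_on UNIV \<and>
     (\<forall>s. 0 < Re s \<longrightarrow> (\<lambda>n. (-1) ^ n / of_nat (Suc n) powr s) sums f s))"

text \<open>Signed Stirling numbers of the first kind:
  x(x-1)...(x-n+1) = sum over l of signed_stirling n l * x^l.\<close>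
definition signed_stirling :: "nat \<Rightarrow> nat \<Rightarrow> int" where
  "signed_stirling n l = (-1) ^ (n - l) * int (stirling n l)"

end

theory Submission
  imports Defs "HOL-Complex_Analysis.Complex_Analysis" "HOL-Number_Theory.Cong"
begin

text \<open>
  A character with vanishing sum over a period is a linear combination of \<open>n \<mapsto> z\<^sup>n\<close> with
  \<open>z \<noteq> 1\<close> a root of unity, so it suffices to treat the Lerch series \<open>\<Sum> z\<^sup>j (j + 1)\<^sup>-\<^sup>s\<close>.
  The binomial sums \<open>B(m, s) = \<Sum> (m choose j) z\<^sup>j (j + 1)\<^sup>-\<^sup>s\<close> are Gamma-type integrals of
  \<open>(1 + z e\<^sup>-\<^sup>t)\<^sup>m\<close>; hence they grow like \<open>\<rho>\<^sup>m\<close> up to powers of \<open>m\<close>, where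
  \<open>\<rho> = max 1 |1 + z| < 2\<close>, locally uniformly in \<open>s\<close>. The integral coefficients \<open>I(m, s0)\<close> decay
  like \<open>2\<^sup>-\<^sup>m\<close>, so \<open>\<Sum> I(m, s0) B(m, s)\<close> is entire in \<open>s\<close>. It is identified with the Lerch function
  at \<open>s + s0\<close> in a half-plane by swapping sums, using
  \<open>\<Sum>\<^sub>m (m choose j) I(m, s0) = (j + 1)\<close> to the power \<open>-s0\<close>.

  The special case \<open>z = -1\<close> of this expansion shows that the coefficients of the second formula
  coincide with \<open>I(m, s0)\<close> for \<open>Re s0 > -1\<close>. Their Stirling recurrence in \<open>s0\<close> is dual to the recurrence
  of \<open>B\<close> in \<open>s\<close>, so Abel summation carries the second formula down to all \<open>s0\<close>.
\<close>

subsection \<open>Gamma-type integrals\<close>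

text \<open>Rescaling the variable by \<open>a\<close> in Euler's integral for
  \<open>Gamma (s + 1)\<close>. The substitution is carried out on Bochner integrals over the whole
  line, with the half-line encoded by an indicator.\<close>

lemma has_integral_powr_exp:
  fixes s :: complex and a :: real
  assumes s: "Re s > -1" and a: "a > 0"
  shows "((\<lambda>x. of_real x powr s * of_real (exp (- a * x))) has_integral
           Gamma (s + 1) / of_real a powr (s + 1)) {0<..}"
proof -
  define f where "f = (\<lambda>t::real. indicator {0<..} t *\<^sub>R (of_real t powr s / of_real (exp t) :: complex))"
  have abs: "(\<lambda>t. complex_of_real t powr s / of_real (exp t)) absolutely_integrable_on {0<..}"
    using absolutely_integrable_Gamma_integral'[of "s + 1"] s by simp
  \<comment> \<open>Borel measurability lets integrability pass from the completed measure to
    \<open>lborel\<close>, where the affine substitution is applied.\<close>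
  have meas: "f \<in> borel_measurable lborel"
  proof -
    have "f \<in> borel_measurable borel"
      unfolding f_def by (intro borel_measurable_continuous_on_indicator continuous_intros) auto
    then show ?thesis by simp
  qed
  have int: "integrable lborel f"
    using abs integrable_completion[OF meas] unfolding set_integrable_def f_def by blast
  have "(f has_integral integral\<^sup>L lborel f) UNIV"
    by (rule has_integral_integral_lborel[OF int])
  moreover have "(f has_integral Gamma (s + 1)) UNIV"
  proof -
    have "((\<lambda>t. of_real t powr s / of_real (exp t)) has_integral Gamma (s + 1)) {0<..}"
      using Gamma_integral_complex'[of "s + 1"] s by simp
    then have "((\<lambda>t. if t \<in> {0<..} then of_real t powr s / of_real (exp t) else 0) has_integral Gamma (s + 1)) UNIV"
      by (simp only: has_integral_restrict_UNIV)
    then show ?thesis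
      by (rule has_integral_eq[rotated]) (auto simp: f_def)
  qed
  ultimately have "has_bochner_integral lborel f (Gamma (s + 1))"
    using int has_integral_unique by (auto simp: has_bochner_integral_iff)
  then have "has_bochner_integral lborel (\<lambda>x. f (0 + a * x)) (Gamma (s + 1) /\<^sub>R \<bar>a\<bar>)"
    using a by (subst (asm) lborel_has_bochner_integral_real_affine_iff[where c = a and t = 0]) auto
  then have "((\<lambda>x. f (a * x)) has_integral (Gamma (s + 1) /\<^sub>R a)) UNIV"
    using a has_integral_integral_lborel[of "\<lambda>x. f (a * x)"] by (auto simp: has_bochner_integral_iff)
  then have "((\<lambda>x. f (a * x) / of_real a powr s) has_integral (Gamma (s + 1) /\<^sub>R a / of_real a powr s)) UNIV"
    by (rule has_integral_divide)
  then have "((\<lambda>x. if x \<in> {0<..} then of_real x powr s * of_real (exp (- a * x)) else 0)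
      has_integral (Gamma (s + 1) /\<^sub>R a / of_real a powr s)) UNIV"
  proof (rule has_integral_eq[rotated])
    fix x :: real
    show "f (a * x) / of_real a powr s = (if x \<in> {0<..} then of_real x powr s * of_real (exp (- a * x)) else 0)"
      using a by (auto simp: f_def zero_less_mult_iff powr_times_real exp_minus field_simps)
  qed
  then have "((\<lambda>x. of_real x powr s * of_real (exp (- a * x))) has_integral
           (Gamma (s + 1) /\<^sub>R a / of_real a powr s)) {0<..}"
    by (simp only: has_integral_restrict_UNIV)
  also have "Gamma (s + 1) /\<^sub>R a / of_real a powr s = Gamma (s + 1) / of_real a powr (s + 1)"
    using a by (simp add: powr_add scaleR_conv_of_real field_simps)
  finally show ?thesis .
qed

lemma norm_of_real_powr: "x > 0 \<Longrightarrow> norm (of_real x powr s :: complex) = x powr Re s"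
  by (simp add: norm_powr_real_powr)

lemma has_integral_powr_exp_real:
  fixes s a :: real
  assumes s: "s > -1" and a: "a > 0"
  shows "((\<lambda>x. x powr s * exp (- a * x)) has_integral Gamma (s + 1) / a powr (s + 1)) {0<..}"
proof -
  have "((\<lambda>x. complex_of_real x powr of_real s * of_real (exp (- a * x))) has_integral
           Gamma (of_real s + 1) / of_real a powr (of_real s + 1)) {0<..}"
    using assms by (intro has_integral_powr_exp) auto
  from has_integral_linear[OF this bounded_linear_Re]
  have "((\<lambda>x. Re (complex_of_real x powr of_real s * of_real (exp (- a * x)))) has_integral
           Re (Gamma (of_real s + 1) / of_real a powr (of_real s + 1))) {0<..}"
    by (simp add: o_def)
  also have "Re (Gamma (of_real s + 1) / of_real a powr (of_real s + 1)) = Gamma (s + 1) / a powr (s + 1)"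
  proof -
    have "Gamma (of_real s + 1) / of_real a powr (of_real s + 1) = complex_of_real (Gamma (s + 1) / a powr (s + 1))"
      using a Gamma_complex_of_real[of "s + 1"] powr_of_real[of a "s + 1"] by simp
    then show ?thesis by simp
  qed
  finally show ?thesis
    by (rule has_integral_eq[rotated]) (simp add: powr_of_real)
qed

text \<open>The majorant \<open>C * (x powr Re s * exp (- x))\<close> integrates to a real Gamma
  value, so the bound depends on \<open>u\<close> only through \<open>C\<close>.\<close>

lemma integrable_on_powr_exp_bounded:
  fixes s :: complex and u :: "real \<Rightarrow> complex"
  assumes s: "Re s > -1" and cont: "continuous_on {0<..} u"
    and bd: "\<And>x. x > 0 \<Longrightarrow> norm (u x) \<le> C * exp (- x)"
  shows "(\<lambda>x. of_real x powr s * u x) integrable_on {0<..}"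
    and "norm (integral {0<..} (\<lambda>x. of_real x powr s * u x)) \<le> C * Gamma (Re s + 1)"
proof -
  have hi: "((\<lambda>x. C * (x powr Re s * exp (- x))) has_integral C * Gamma (Re s + 1)) {0<..}"
    using has_integral_mult_right[OF has_integral_powr_exp_real[OF s, of 1], of C] by simp
  have le: "norm (of_real x powr s * u x) \<le> C * (x powr Re s * exp (- x))" if "x \<in> {0<..}" for x :: real
    using bd[of x] that mult_left_mono[of "norm (u x)" "C * exp (- x)" "x powr Re s"]
    by (simp add: norm_mult norm_of_real_powr mult_ac)
  have "(\<lambda>x. of_real x powr s * u x) absolutely_integrable_on {0<..}"
  proof (rule measurable_bounded_by_integrable_imp_absolutely_integrable[OF _ _ _ le])
    show "(\<lambda>x. of_real x powr s * u x) \<in> borel_measurable (lebesgue_on {0<..})"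
      by (intro continuous_imp_measurable_on_sets_lebesgue continuous_intros cont) auto
    show "(\<lambda>x. C * (x powr Re s * exp (- x))) integrable_on {0<..}"
      using hi by blast
  qed auto
  then show int: "(\<lambda>x. of_real x powr s * u x) integrable_on {0<..}"
    using set_lebesgue_integral_eq_integral(1) by blast
  show "norm (integral {0<..} (\<lambda>x. of_real x powr s * u x)) \<le> C * Gamma (Re s + 1)"
    using integral_norm_bound_integral[OF int has_integral_integrable[OF hi] le]
    unfolding integral_unique[OF hi] .
qed

text \<open>Dominated convergence in the form used for every infinite series integrated below: the
  partial sums need a common multiple of \<open>exp (- x)\<close> as majorant.\<close>

lemma integral_powr_exp_tendsto:
  fixes s :: complex and u :: "nat \<Rightarrow> real \<Rightarrow> complex"
  assumes s: "Re s > -1" and cont: "\<And>n. continuous_on {0<..} (u n)"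
    and bd: "\<And>n x. x > 0 \<Longrightarrow> norm (u n x) \<le> C * exp (- x)"
    and lim: "\<And>x. x > 0 \<Longrightarrow> (\<lambda>n. u n x) \<longlonglongrightarrow> v x"
  shows "(\<lambda>n. integral {0<..} (\<lambda>x. of_real x powr s * u n x))
           \<longlonglongrightarrow> integral {0<..} (\<lambda>x. of_real x powr s * v x)"
proof (rule dominated_convergence(2))
  show "(\<lambda>x. of_real x powr s * u n x) integrable_on {0<..}" for n
    by (rule integrable_on_powr_exp_bounded[OF s cont bd])
  show "(\<lambda>x. C * (x powr Re s * exp (- x))) integrable_on {0<..}"
    using has_integral_mult_right[OF has_integral_powr_exp_real[OF s, of 1], of C] by auto
  show "norm (of_real x powr s * u n x) \<le> C * (x powr Re s * exp (- x))" if "x \<in> {0<..}" for n and x :: real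
    using bd[of x n] that mult_left_mono[of "norm (u n x)" "C * exp (- x)" "x powr Re s"]
    by (simp add: norm_mult norm_of_real_powr mult_ac)
  show "(\<lambda>n. of_real x powr s * u n x) \<longlonglongrightarrow> of_real x powr s * v x" if "x \<in> {0<..}" for x :: real
    using that by (intro tendsto_intros lim) auto
qed

subsection \<open>Coefficients of the integral formula\<close>

text \<open>Newton's binomial series for the exponent \<open>- (k + 1)\<close>, with the index
  shifted by \<open>k\<close>.\<close>

lemma binomial_column_sums:
  fixes w :: real
  assumes "\<bar>w\<bar> < 1"
  shows "(\<lambda>n. real (n choose k) * w ^ n) sums (w ^ k / (1 - w) ^ Suc k)"
proof -
  have "(\<lambda>n. ((- real (Suc k)) gchoose n) * (- w) ^ n) sums (1 + (- w)) powr (- real (Suc k))"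
    using assms by (intro gen_binomial_real) auto
  also have "(\<lambda>n. ((- real (Suc k)) gchoose n) * (- w) ^ n) = (\<lambda>n. real ((n + k) choose k) * w ^ n)"
  proof
    fix n
    have "(- real (Suc k)) gchoose n = (-1) ^ n * (real (n + k) gchoose n)"
      by (subst gbinomial_negated_upper) (simp add: algebra_simps)
    also have "real (n + k) gchoose n = real ((n + k) choose k)"
      using binomial_symmetric[of n "n + k"] by (simp only: binomial_gbinomial[symmetric]) simp
    finally show "((- real (Suc k)) gchoose n) * (- w) ^ n = real ((n + k) choose k) * w ^ n"
      by (simp add: power_minus[of w])
  qed
  also have "(1 + (- w)) powr (- real (Suc k)) = 1 / (1 - w) ^ Suc k"
    using assms by (simp add: powr_minus powr_realpow field_simps del: of_nat_Suc power_Suc)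
  finally have "(\<lambda>n. w ^ k * (real ((n + k) choose k) * w ^ n)) sums (w ^ k * (1 / (1 - w) ^ Suc k))"
    by (rule sums_mult)
  then have "(\<lambda>n. real ((n + k) choose k) * w ^ (n + k)) sums (w ^ k / (1 - w) ^ Suc k)"
    by (simp add: power_add mult_ac)
  \<comment> \<open>The terms with \<open>n < k\<close> vanish, so undoing the shift does not change
    the sum.\<close>
  then show ?thesis
    by (subst (asm) sums_iff_shift) (simp add: binomial_eq_0)
qed

text \<open>With \<open>u = exp (- x) / (1 + exp (- x))\<close>, the function
  \<open>(m + 1) * euler_weight m x\<close> is minus the derivative of
  \<open>u ^ (m + 1)\<close>.\<close>

definition euler_weight :: "nat \<Rightarrow> real \<Rightarrow> real" where
  "euler_weight m x = exp (- x * real (m + 1)) / (1 + exp (- x)) ^ (m + 2)"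

lemma euler_weight_nonneg: "euler_weight m x \<ge> 0"
  by (simp add: euler_weight_def)

lemma continuous_on_euler_weight [continuous_intros]: "continuous_on A (euler_weight m)"
  unfolding euler_weight_def
  by (intro continuous_intros) (auto simp: add_pos_pos less_imp_neq[symmetric])

lemma euler_weight_eq:
  "euler_weight m x = exp (- x) / (1 + exp (- x))\<^sup>2 * (exp (- x) / (1 + exp (- x))) ^ m"
proof -
  have "exp (- x * real (m + 1)) = exp (- x) ^ (m + 1)"
    by (subst exp_of_nat_mult[symmetric]) (simp add: mult_ac)
  then show ?thesis
    by (simp add: euler_weight_def power_divide power2_eq_square)
qed

text \<open>The base \<open>exp (- x) / (1 + exp (- x))\<close> of the geometric factor is at most
  1/2 on the half-line; this is the source of the decay of the coefficients.\<close>

lemma euler_weight_le: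
  assumes "x \<ge> 0"
  shows "euler_weight m x \<le> (1 / 2 ^ m) * exp (- x)"
proof -
  have "(1 + exp (- x)) > 0" by (simp add: add_pos_pos)
  then have "exp (- x) / (1 + exp (- x)) \<le> 1 / 2"
    using assms by (simp add: field_simps)
  then have "(exp (- x) / (1 + exp (- x))) ^ m \<le> (1 / 2) ^ m"
    by (intro power_mono) (auto simp: add_nonneg_nonneg)
  moreover have "exp (- x) / (1 + exp (- x))\<^sup>2 \<le> exp (- x)"
    by (simp add: divide_le_eq add_pos_pos)
  ultimately have "exp (- x) / (1 + exp (- x))\<^sup>2 * (exp (- x) / (1 + exp (- x))) ^ m \<le> exp (- x) * (1 / 2) ^ m"
    by (intro mult_mono) (auto simp: add_nonneg_nonneg)
  then show ?thesis
    by (simp add: euler_weight_eq power_divide)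
qed

text \<open>Since \<open>1 - w = 1 / (1 + y)\<close>, the column sum of the binomials over
  \<open>j + 1\<close> collapses to a single exponential.\<close>

lemma euler_weight_binomial_sums:
  assumes "x > 0"
  shows "(\<lambda>m. real (m + 1) * real (m choose j) * euler_weight m x)
           sums (real (j + 1) * exp (- real (j + 1) * x))"
proof -
  define y where "y = exp (- x)"
  define w where "w = y / (1 + y)"
  have y: "y > 0" by (simp add: y_def)
  have w: "\<bar>w\<bar> < 1" "1 - w = 1 / (1 + y)" using y by (auto simp: w_def field_simps)
  have "(\<lambda>n. real (n choose Suc j) * w ^ n) sums (w ^ Suc j / (1 - w) ^ Suc (Suc j))"
    using binomial_column_sums[OF w(1)] .
  also have "w ^ Suc j / (1 - w) ^ Suc (Suc j) = y ^ Suc j * (1 + y)"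
  proof -
    have "1 + y \<noteq> 0" using y by simp
    then show ?thesis
      unfolding w(2) by (simp add: w_def power_divide)
  qed
  finally have "(\<lambda>m. real (Suc m choose Suc j) * w ^ Suc m) sums (y ^ Suc j * (1 + y))"
    by (subst sums_Suc_iff) simp
  then have "(\<lambda>m. real (j + 1) / (1 + y) * (real (Suc m choose Suc j) * w ^ Suc m)) sums
               (real (j + 1) / (1 + y) * (y ^ Suc j * (1 + y)))"
    by (rule sums_mult)
  also have "real (j + 1) / (1 + y) * (y ^ Suc j * (1 + y)) = real (j + 1) * y ^ Suc j"
    using y by (simp add: field_simps)
  also have "y ^ Suc j = exp (- real (j + 1) * x)"
    unfolding y_def by (subst exp_of_nat_mult[symmetric]) (simp add: algebra_simps)
  also have "(\<lambda>m. real (j + 1) / (1 + y) * (real (Suc m choose Suc j) * w ^ Suc m)) =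
             (\<lambda>m. real (m + 1) * real (m choose j) * euler_weight m x)"
  proof
    fix m
    \<comment> \<open>Absorption trades the factor \<open>m + 1\<close>, which varies with the
      summation index, for the constant \<open>j + 1\<close>.\<close>
    have *: "real (j + 1) * real (Suc m choose Suc j) = real (m + 1) * real (m choose j)"
      using Suc_times_binomial_eq[of m j] by (simp only: of_nat_mult[symmetric]) (simp add: mult_ac)
    have "real (j + 1) / (1 + y) * (real (Suc m choose Suc j) * w ^ Suc m) =
        (real (j + 1) * real (Suc m choose Suc j)) * (w ^ Suc m / (1 + y))"
      by (simp only: times_divide_eq_left times_divide_eq_right mult_ac)
    also note *
    also have "w ^ Suc m / (1 + y) = euler_weight m x"
      using y by (simp add: euler_weight_eq flip: y_def) (simp add: w_def power2_eq_square)
    finally show "real (j + 1) / (1 + y) * (real (Suc m choose Suc j) * w ^ Suc m) =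
        real (m + 1) * real (m choose j) * euler_weight m x" .
  qed
  finally show ?thesis .
qed

text \<open>All terms are nonnegative, so the total is a majorant uniform in \<open>n\<close>, as
  dominated convergence requires.\<close>

lemma sum_euler_weight_binomial_le:
  assumes "x > 0"
  shows "(\<Sum>m<n. real (m + 1) * real (m choose j) * euler_weight m x)
           \<le> real (j + 1) * exp (- real (j + 1) * x)"
  unfolding sums_unique[OF euler_weight_binomial_sums[OF assms]]
  by (intro sum_le_suminf sums_summable[OF euler_weight_binomial_sums[OF assms]])
     (auto simp: euler_weight_nonneg)

text \<open>Spelled out literally as in the first formula, so that folding the definition matches
  the theorem; calculations go through \<open>euler_coeff_altdef\<close>.\<close>

definition euler_coeff :: "nat \<Rightarrow> complex \<Rightarrow> complex" where
  "euler_coeff m s = 1 / Gamma (s + 1) * of_nat (m + 1) *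
     integral {0<..} (\<lambda>x::real. of_real x powr s * of_real (exp (- x * real (m + 1)))
                        / of_real ((1 + exp (- x)) ^ (m + 2)))"

lemma euler_coeff_altdef:
  "euler_coeff m s = of_nat (m + 1) / Gamma (s + 1) *
     integral {0<..} (\<lambda>x. of_real x powr s * of_real (euler_weight m x))"
  by (simp add: euler_coeff_def euler_weight_def)

lemma norm_euler_weight_le:
  "x > 0 \<Longrightarrow> norm (of_real (euler_weight m x) :: complex) \<le> (1 / 2 ^ m) * exp (- x)"
  using euler_weight_le[of x m] euler_weight_nonneg[of m x] by simp

lemma integrable_euler_weight:
  assumes "Re s > -1"
  shows "(\<lambda>x. of_real x powr s * of_real (euler_weight m x) :: complex) integrable_on {0<..}"
  by (rule integrable_on_powr_exp_bounded[OF assms _ norm_euler_weight_le])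
     (auto intro!: continuous_intros)

lemma integrable_euler_weight_real:
  assumes "s > -1"
  shows "(\<lambda>x. x powr s * euler_weight m x) integrable_on {0<..}"
proof -
  have "(\<lambda>x. complex_of_real x powr of_real s * of_real (euler_weight m x)) integrable_on {0<..}"
    using integrable_euler_weight[of "of_real s"] assms by simp
  from integrable_linear[OF this bounded_linear_Re]
  have "(\<lambda>x. Re (complex_of_real x powr of_real s * of_real (euler_weight m x))) integrable_on {0<..}"
    by (simp add: o_def)
  then show ?thesis
    by (rule integrable_eq) (simp add: powr_of_real)
qed

lemma Gamma_plus_1_nonzero: "Re s > -1 \<Longrightarrow> Gamma (s + 1) \<noteq> (0 :: complex)"
proof
  assume "Re s > -1" "Gamma (s + 1) = 0"
  then obtain n where "s + 1 = of_int n" "n \<le> 0"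
    by (auto simp: Gamma_eq_zero_iff elim!: nonpos_Ints_cases)
  then have "Re (s + 1) \<le> 0" by simp
  with \<open>Re s > -1\<close> show False by simp
qed

lemma norm_euler_coeff_le:
  assumes "Re s > -1"
  shows "norm (euler_coeff m s) \<le> Gamma (Re s + 1) / norm (Gamma (s + 1)) * (real (m + 1) / 2 ^ m)"
proof -
  have "norm (integral {0<..} (\<lambda>x. of_real x powr s * of_real (euler_weight m x) :: complex))
          \<le> (1 / 2 ^ m) * Gamma (Re s + 1)"
    by (rule integrable_on_powr_exp_bounded[OF assms _ norm_euler_weight_le])
       (auto intro!: continuous_intros)
  then have "real (m + 1) / norm (Gamma (s + 1)) * norm (integral {0<..} (\<lambda>x. of_real x powr s * of_real (euler_weight m x) :: complex))
       \<le> real (m + 1) / norm (Gamma (s + 1)) * ((1 / 2 ^ m) * Gamma (Re s + 1))"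
    by (intro mult_left_mono) auto
  then show ?thesis
    unfolding euler_coeff_altdef norm_mult norm_divide norm_of_nat by (simp add: mult_ac)
qed

text \<open>Termwise integration of \<open>euler_weight_binomial_sums\<close> against
  \<open>x powr s\<close>. The Gamma integral with rate \<open>j + 1\<close> yields the exponent
  \<open>- (s + 1)\<close>, and the prefactor \<open>j + 1\<close> cancels one power.\<close>

lemma euler_coeff_binomial_sums:
  assumes s: "Re s > -1"
  shows "(\<lambda>m. of_nat (m choose j) * euler_coeff m s) sums (1 / of_nat (j + 1) powr s)"
proof -
  define u where "u = (\<lambda>n x. complex_of_real (\<Sum>m<n. real (m + 1) * real (m choose j) * euler_weight m x))"
  define v where "v = (\<lambda>x. complex_of_real (real (j + 1) * exp (- real (j + 1) * x)))"
  have "(\<lambda>n. integral {0<..} (\<lambda>x. of_real x powr s * u n x))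
           \<longlonglongrightarrow> integral {0<..} (\<lambda>x. of_real x powr s * v x)"
  proof (rule integral_powr_exp_tendsto[OF s])
    show "continuous_on {0<..} (u n)" for n
      unfolding u_def by (intro continuous_intros)
    show "(\<lambda>n. u n x) \<longlonglongrightarrow> v x" if "x > 0" for x
      unfolding u_def v_def using euler_weight_binomial_sums[OF that, of j]
      by (intro tendsto_of_real) (simp add: sums_def)
    show "norm (u n x) \<le> real (j + 1) * exp (- x)" if "x > 0" for n x
    proof -
      have "(\<Sum>m<n. real (m + 1) * real (m choose j) * euler_weight m x) \<le> real (j + 1) * exp (- real (j + 1) * x)"
        by (rule sum_euler_weight_binomial_le[OF that])
      also have "\<dots> \<le> real (j + 1) * exp (- x)"
        using that by (intro mult_left_mono) (auto simp: algebra_simps)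
      finally have "(\<Sum>m<n. real (m + 1) * real (m choose j) * euler_weight m x) \<le> real (j + 1) * exp (- x)" .
      moreover have "(\<Sum>m<n. real (m + 1) * real (m choose j) * euler_weight m x) \<ge> 0"
        by (intro sum_nonneg) (auto simp: euler_weight_nonneg)
      ultimately show ?thesis
        unfolding u_def norm_of_real by simp
    qed
  qed
  also have "integral {0<..} (\<lambda>x. of_real x powr s * v x) = Gamma (s + 1) / of_nat (j + 1) powr s"
  proof -
    have "((\<lambda>x. of_nat (j + 1) * (of_real x powr s * of_real (exp (- real (j + 1) * x)))) has_integral
             of_nat (j + 1) * (Gamma (s + 1) / of_real (real (j + 1)) powr (s + 1))) {0<..}"
      by (intro has_integral_mult_right has_integral_powr_exp[OF s]) auto
    moreover have "of_nat (j + 1) * (Gamma (s + 1) / of_real (real (j + 1)) powr (s + 1)) =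
        Gamma (s + 1) / of_nat (j + 1) powr s"
      unfolding powr_add by (simp add: divide_inverse del: of_nat_Suc of_nat_add)
    moreover have "(\<lambda>x. of_nat (j + 1) * (of_real x powr s * of_real (exp (- real (j + 1) * x)))) =
        (\<lambda>x. of_real x powr s * v x)"
      by (simp add: v_def fun_eq_iff)
    ultimately show ?thesis
      by (metis integral_unique)
  qed
  finally have "(\<lambda>n. integral {0<..} (\<lambda>x. of_real x powr s * u n x) / Gamma (s + 1))
      \<longlonglongrightarrow> Gamma (s + 1) / of_nat (j + 1) powr s / Gamma (s + 1)"
    using Gamma_plus_1_nonzero[OF s] by (intro tendsto_divide tendsto_const)
  also have "Gamma (s + 1) / of_nat (j + 1) powr s / Gamma (s + 1) = 1 / of_nat (j + 1) powr s"
    using Gamma_plus_1_nonzero[OF s] by simp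
  also have "(\<lambda>n. integral {0<..} (\<lambda>x. of_real x powr s * u n x) / Gamma (s + 1)) =
      (\<lambda>n. \<Sum>m<n. of_nat (m choose j) * euler_coeff m s)"
  proof
    fix n
    have "integral {0<..} (\<lambda>x. of_real x powr s * u n x) =
        integral {0<..} (\<lambda>x. \<Sum>m<n. (of_nat (m + 1) * of_nat (m choose j)) * (of_real x powr s * of_real (euler_weight m x)))"
      by (intro arg_cong[where f = "integral _"]) (simp add: u_def fun_eq_iff sum_distrib_left mult_ac)
    also have "\<dots> = (\<Sum>m<n. integral {0<..} (\<lambda>x. (of_nat (m + 1) * of_nat (m choose j)) * (of_real x powr s * of_real (euler_weight m x))))"
      by (intro integral_sum integrable_on_mult_right integrable_euler_weight[OF s]) auto
    also have "\<dots> = (\<Sum>m<n. (of_nat (m + 1) * of_nat (m choose j)) * integral {0<..} (\<lambda>x. of_real x powr s * of_real (euler_weight m x)))"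
      by (intro sum.cong refl integral_mult_right)
    finally show "integral {0<..} (\<lambda>x. of_real x powr s * u n x) / Gamma (s + 1) = (\<Sum>m<n. of_nat (m choose j) * euler_coeff m s)"
      by (simp add: sum_divide_distrib euler_coeff_altdef mult_ac)
  qed
  finally show ?thesis
    by (simp add: sums_def)
qed

text \<open>The weights are nonnegative, so taking norms inside the integral merely replaces
  \<open>s\<close> by \<open>Re s\<close>. The resulting absolute bound, uniform in
  \<open>n\<close>, later justifies swapping a double sum.\<close>

lemma sum_binomial_norm_euler_coeff_le:
  assumes s: "Re s > -1"
  shows "(\<Sum>m<n. real (m choose j) * norm (euler_coeff m s))
           \<le> Gamma (Re s + 1) / norm (Gamma (s + 1)) * real (j + 1) powr (- Re s)"
proof -
  let ?I = "\<lambda>m. integral {0<..} (\<lambda>x. x powr Re s * euler_weight m x)"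
  have le: "norm (integral {0<..} (\<lambda>x. of_real x powr s * of_real (euler_weight m x) :: complex)) \<le> ?I m" for m
    by (rule integral_norm_bound_integral[OF integrable_euler_weight[OF s] integrable_euler_weight_real[OF s]])
       (simp add: norm_mult norm_of_real_powr euler_weight_nonneg)
  have "(\<Sum>m<n. real (m choose j) * norm (euler_coeff m s)) \<le>
        (\<Sum>m<n. (real (m + 1) * real (m choose j)) * ?I m / norm (Gamma (s + 1)))"
  proof (rule sum_mono)
    fix m
    have "real (m choose j) * norm (euler_coeff m s) = (real (m + 1) * real (m choose j)) / norm (Gamma (s + 1)) *
      norm (integral {0<..} (\<lambda>x. of_real x powr s * of_real (euler_weight m x) :: complex))"
      unfolding euler_coeff_altdef norm_mult norm_divide norm_of_nat by simp
    also have "\<dots> \<le> (real (m + 1) * real (m choose j)) / norm (Gamma (s + 1)) * ?I m"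
      using le by (intro mult_left_mono) auto
    finally show "real (m choose j) * norm (euler_coeff m s) \<le> (real (m + 1) * real (m choose j)) * ?I m / norm (Gamma (s + 1))"
      by simp
  qed
  also have "\<dots> = (\<Sum>m<n. (real (m + 1) * real (m choose j)) * ?I m) / norm (Gamma (s + 1))"
    by (simp add: sum_divide_distrib)
  also have "(\<Sum>m<n. (real (m + 1) * real (m choose j)) * ?I m) =
     (\<Sum>m<n. integral {0<..} (\<lambda>x. (real (m + 1) * real (m choose j)) * (x powr Re s * euler_weight m x)))"
    by (intro sum.cong refl integral_mult_right[symmetric])
  also have "\<dots> = integral {0<..} (\<lambda>x. \<Sum>m<n. (real (m + 1) * real (m choose j)) * (x powr Re s * euler_weight m x))"
    by (intro integral_sum[symmetric] integrable_on_mult_right integrable_euler_weight_real[OF s]) auto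
  also have "\<dots> \<le> real (j + 1) * (Gamma (Re s + 1) / real (j + 1) powr (Re s + 1))"
  proof (rule has_integral_le)
    show "((\<lambda>x. \<Sum>m<n. (real (m + 1) * real (m choose j)) * (x powr Re s * euler_weight m x)) has_integral
        integral {0<..} (\<lambda>x. \<Sum>m<n. (real (m + 1) * real (m choose j)) * (x powr Re s * euler_weight m x))) {0<..}"
      by (intro integrable_integral integrable_sum integrable_on_mult_right integrable_euler_weight_real[OF s]) auto
    show "((\<lambda>x. real (j + 1) * (x powr Re s * exp (- real (j + 1) * x))) has_integral
       real (j + 1) * (Gamma (Re s + 1) / real (j + 1) powr (Re s + 1))) {0<..}"
      by (intro has_integral_mult_right has_integral_powr_exp_real[OF s]) auto
    fix x :: real assume "x \<in> {0<..}"
    then have "(\<Sum>m<n. real (m + 1) * real (m choose j) * euler_weight m x) \<le> real (j + 1) * exp (- real (j + 1) * x)"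
      by (intro sum_euler_weight_binomial_le) auto
    from mult_left_mono[OF this, of "x powr Re s"]
    show "(\<Sum>m<n. (real (m + 1) * real (m choose j)) * (x powr Re s * euler_weight m x))
            \<le> real (j + 1) * (x powr Re s * exp (- real (j + 1) * x))"
      by (simp only: powr_ge_zero sum_distrib_left mult_ac)
  qed
  also have "real (j + 1) * (Gamma (Re s + 1) / real (j + 1) powr (Re s + 1)) = Gamma (Re s + 1) * real (j + 1) powr (- Re s)"
    unfolding powr_add powr_minus by (simp add: divide_inverse)
  finally show ?thesis
    by (simp add: divide_right_mono)
qed

subsection \<open>Binomial sums\<close>

definition binom_sum :: "complex \<Rightarrow> nat \<Rightarrow> complex \<Rightarrow> complex" where
  "binom_sum z m s = (\<Sum>j=0..m. z ^ j * of_nat (m choose j) / of_nat (j + 1) powr s)"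

text \<open>Lowering \<open>s\<close> by one multiplies the \<open>j\<close>-th term by
  \<open>j + 1\<close>, and \<open>(m + 1) * (m choose j) - m * ((m - 1) choose j) = (j + 1) * (m
  choose j)\<close>.\<close>

lemma binom_sum_diff_1:
  "binom_sum z m (s - 1) = of_nat (m + 1) * binom_sum z m s - of_nat m * binom_sum z (m - 1) s"
proof -
  have "of_nat m * binom_sum z (m - 1) s =
          (\<Sum>j=0..m-1. z ^ j * (of_nat m * of_nat ((m - 1) choose j)) / of_nat (j + 1) powr s)"
    by (simp add: binom_sum_def sum_distrib_left mult_ac)
  \<comment> \<open>The added term \<open>j = m\<close> has a zero binomial; for
    \<open>m = 0\<close> truncated subtraction makes the two ranges equal.\<close>
  also have "\<dots> = (\<Sum>j=0..m. z ^ j * (of_nat m * of_nat ((m - 1) choose j)) / of_nat (j + 1) powr s)"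
    by (rule sum.mono_neutral_left) (auto simp: binomial_eq_0)
  finally have "of_nat (m + 1) * binom_sum z m s - of_nat m * binom_sum z (m - 1) s =
      (\<Sum>j=0..m. of_nat (m + 1) * (z ^ j * of_nat (m choose j) / of_nat (j + 1) powr s)
        - z ^ j * (of_nat m * of_nat ((m - 1) choose j)) / of_nat (j + 1) powr s)"
    by (simp only: binom_sum_def sum_distrib_left sum_subtractf)
  also have "\<dots> = binom_sum z m (s - 1)"
    unfolding binom_sum_def
  proof (rule sum.cong[OF refl])
    fix j assume j: "j \<in> {0..m}"
    have "of_nat m * of_nat ((m - 1) choose j) = (of_nat m - of_nat j :: complex) * of_nat (m choose j)"
      using binomial_absorb_comp[of m j] j by (simp flip: of_nat_mult of_nat_diff)
    then have *: "of_nat (m + 1) * of_nat (m choose j) - of_nat m * of_nat ((m - 1) choose j) =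
        of_nat (j + 1) * (of_nat (m choose j) :: complex)"
      by (simp add: algebra_simps)
    have "of_nat (m + 1) * (z ^ j * of_nat (m choose j) / of_nat (j + 1) powr s)
        - z ^ j * (of_nat m * of_nat ((m - 1) choose j)) / of_nat (j + 1) powr s =
        z ^ j * (of_nat (m + 1) * of_nat (m choose j) - of_nat m * of_nat ((m - 1) choose j)) / of_nat (j + 1) powr s"
      by (simp only: right_diff_distrib diff_divide_distrib mult_ac times_divide_eq_right)
    also have "\<dots> = z ^ j * of_nat (m choose j) * (of_nat (j + 1) / of_nat (j + 1) powr s)"
      unfolding * by (simp only: mult_ac times_divide_eq_right)
    also have "of_nat (j + 1) / of_nat (j + 1) powr s = 1 / (of_nat (j + 1) powr (s - 1) :: complex)"
      unfolding powr_diff by (simp del: of_nat_Suc of_nat_add)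
    finally show "of_nat (m + 1) * (z ^ j * of_nat (m choose j) / of_nat (j + 1) powr s)
        - z ^ j * (of_nat m * of_nat ((m - 1) choose j)) / of_nat (j + 1) powr s =
        z ^ j * of_nat (m choose j) / of_nat (j + 1) powr (s - 1)" by simp
  qed
  finally show ?thesis ..
qed

text \<open>Binomial expansion of the power and one Gamma integral per term.\<close>

lemma has_integral_Gamma_binom_sum:
  assumes s: "Re s > 0"
  shows "((\<lambda>t. of_real t powr (s - 1) * (of_real (exp (- t)) * (1 + z * of_real (exp (- t))) ^ m))
           has_integral (Gamma s * binom_sum z m s)) {0<..}"
proof -
  have "((\<lambda>t. \<Sum>j=0..m. (z ^ j * of_nat (m choose j)) * (of_real t powr (s - 1) * of_real (exp (- real (j + 1) * t))))
          has_integral (\<Sum>j=0..m. (z ^ j * of_nat (m choose j)) * (Gamma (s - 1 + 1) / of_real (real (j + 1)) powr (s - 1 + 1)))) {0<..}"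
    using s by (intro has_integral_sum has_integral_mult_right has_integral_powr_exp) auto
  also have "(\<Sum>j=0..m. (z ^ j * of_nat (m choose j)) * (Gamma (s - 1 + 1) / of_real (real (j + 1)) powr (s - 1 + 1)))
      = Gamma s * binom_sum z m s"
    by (simp add: binom_sum_def sum_distrib_left mult_ac)
  also have "(\<lambda>t. \<Sum>j=0..m. (z ^ j * of_nat (m choose j)) * (of_real t powr (s - 1) * of_real (exp (- real (j + 1) * t)))) =
     (\<lambda>t. of_real t powr (s - 1) * (of_real (exp (- t)) * (1 + z * of_real (exp (- t))) ^ m))"
  proof
    fix t :: real
    have "exp (- real (j + 1) * t) = exp (- t) * exp (- t) ^ j" for j
      by (simp add: exp_of_nat_mult[symmetric] exp_add[symmetric] algebra_simps)
    then have e: "complex_of_real (exp (- real (j + 1) * t)) = of_real (exp (- t)) * of_real (exp (- t)) ^ j" for j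
      by simp
    have "(1 + z * of_real (exp (- t))) ^ m = (\<Sum>j=0..m. of_nat (m choose j) * (z * of_real (exp (- t))) ^ j)"
      using binomial_ring[of "z * of_real (exp (- t))" 1 m] by (simp add: add.commute atMost_atLeast0)
    then show "(\<Sum>j=0..m. (z ^ j * of_nat (m choose j)) * (of_real t powr (s - 1) * of_real (exp (- real (j + 1) * t)))) =
      of_real t powr (s - 1) * (of_real (exp (- t)) * (1 + z * of_real (exp (- t))) ^ m)"
      unfolding e by (simp add: sum_distrib_left power_mult_distrib mult_ac)
  qed
  finally show ?thesis .
qed

section \<open>Exponential growth of the binomial sums in \<open>m\<close>\<close>

definition growth_rate :: "complex \<Rightarrow> real" where
  "growth_rate z = max 1 (norm (1 + z))"

lemma growth_rate_ge_1: "growth_rate z \<ge> 1"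
  by (simp add: growth_rate_def)

text \<open>On the unit circle the square of \<open>norm (1 + z)\<close> is
  \<open>2 + 2 * Re z\<close>, which reaches 4 only at \<open>z = 1\<close>.\<close>

lemma growth_rate_less_2:
  assumes "norm z = 1" "z \<noteq> 1"
  shows "growth_rate z < 2"
proof -
  have "norm (1 + z) < 2"
  proof (rule ccontr)
    assume "\<not> norm (1 + z) < 2"
    then have "2\<^sup>2 \<le> (norm (1 + z))\<^sup>2"
      by (intro power_mono) auto
    moreover have 1: "(Re z)\<^sup>2 + (Im z)\<^sup>2 = 1"
      using assms(1) cmod_power2[of z] by simp
    moreover from 1 have "(norm (1 + z))\<^sup>2 = 2 + 2 * Re z"
      unfolding cmod_power2 by (simp add: power2_eq_square algebra_simps)
    ultimately have "Re z \<ge> 1" by simp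
    then have "(Re z)\<^sup>2 \<ge> 1" by simp
    with 1 have "Im z = 0" by (smt (verit) power2_less_0 zero_eq_power2)
    with 1 \<open>Re z \<ge> 1\<close> have "z = 1" by (simp add: complex_eq_iff power2_eq_1_iff)
    with assms(2) show False by simp
  qed
  then show ?thesis by (simp add: growth_rate_def)
qed

text \<open>The point \<open>1 + z * r\<close> lies on the segment from 1 to \<open>1 + z\<close>,
  and the norm is convex; \<open>growth_rate z\<close> is the larger of its two endpoint
  values.\<close>

lemma norm_one_plus_mult_le_growth_rate:
  assumes "0 \<le> r" "r \<le> 1"
  shows "norm (1 + z * of_real r) \<le> growth_rate z"
proof -
  have "1 + z * of_real r = of_real (1 - r) + of_real r * (1 + z)"
    by (simp add: algebra_simps)
  then have "norm (1 + z * of_real r) \<le> norm (of_real (1 - r) :: complex) + norm (of_real r * (1 + z))"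
    using norm_triangle_ineq by metis
  also have "\<dots> = (1 - r) * 1 + r * norm (1 + z)"
    using assms by (simp only: norm_mult norm_of_real) simp
  also have "\<dots> \<le> (1 - r) * growth_rate z + r * growth_rate z"
    using assms by (intro add_mono mult_left_mono) (auto simp: growth_rate_def)
  finally show ?thesis by (simp add: algebra_simps)
qed

lemma norm_binom_sum_le:
  assumes s: "Re s > 0"
  shows "norm (binom_sum z m s) \<le> Gamma (Re s) / norm (Gamma s) * growth_rate z ^ m"
proof -
  have "norm (integral {0<..} (\<lambda>t. of_real t powr (s - 1) * (of_real (exp (- t)) * (1 + z * of_real (exp (- t))) ^ m)))
          \<le> growth_rate z ^ m * Gamma (Re (s - 1) + 1)"
  proof (rule integrable_on_powr_exp_bounded)
    show "Re (s - 1) > -1" using s by simp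
    show "norm (of_real (exp (- t)) * (1 + z * of_real (exp (- t))) ^ m) \<le> growth_rate z ^ m * exp (- t)" if "t > 0" for t
      using norm_one_plus_mult_le_growth_rate[of "exp (- t)" z] that
      by (auto simp: norm_mult norm_power mult_ac intro!: mult_left_mono power_mono)
  qed (intro continuous_intros)
  moreover have "integral {0<..} (\<lambda>t. of_real t powr (s - 1) * (of_real (exp (- t)) * (1 + z * of_real (exp (- t))) ^ m))
      = Gamma s * binom_sum z m s"
    by (rule integral_unique[OF has_integral_Gamma_binom_sum[OF s]])
  moreover have "Gamma s \<noteq> 0"
    using Gamma_plus_1_nonzero[of "s - 1"] s by simp
  ultimately show ?thesis
    by (simp add: norm_mult field_simps)
qed

text \<open>The integral bound covers compact sets in \<open>Re s > 0\<close>, where the Gamma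
  quotient is bounded by continuity. Each further strip to the left is reached through
  \<open>binom_sum_diff_1\<close>, at the cost of one more factor \<open>m + 1\<close>.\<close>

lemma binom_sum_bounded_compact:
  assumes K: "compact K"
  shows "\<exists>C k. C \<ge> 0 \<and> (\<forall>s\<in>K. \<forall>m. norm (binom_sum z m s) \<le> C * real (m + 1) ^ k * growth_rate z ^ m)"
proof -
  have *: "\<exists>C k. C \<ge> 0 \<and> (\<forall>s\<in>K. \<forall>m. norm (binom_sum z m s) \<le> C * real (m + 1) ^ k * growth_rate z ^ m)"
    if "compact K" "\<And>s. s \<in> K \<Longrightarrow> Re s > - real n" for K n
    using that
  proof (induction n arbitrary: K)
    case 0
    have nz: "s \<notin> \<int>\<^sub>\<le>\<^sub>0" "Re s \<notin> \<int>\<^sub>\<le>\<^sub>0" if "s \<in> K" for s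
      using 0(2)[OF that] by (auto elim!: nonpos_Ints_cases)
    have "continuous_on K (\<lambda>s. Gamma (Re s) / norm (Gamma s))"
      using nz by (intro continuous_intros continuous_on_compose2[OF continuous_on_Gamma[of "Re ` K"]])
        (auto simp: Gamma_eq_zero_iff)
    from compact_imp_bounded[OF compact_continuous_image[OF this 0(1)]]
    obtain C where C: "\<And>s. s \<in> K \<Longrightarrow> \<bar>Gamma (Re s) / norm (Gamma s)\<bar> \<le> C"
      by (auto simp: bounded_iff)
    have "norm (binom_sum z m s) \<le> max C 0 * real (m + 1) ^ 0 * growth_rate z ^ m" if "s \<in> K" for s m
    proof -
      have "norm (binom_sum z m s) \<le> Gamma (Re s) / norm (Gamma s) * growth_rate z ^ m"
        using 0(2)[OF that] by (intro norm_binom_sum_le) simp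
      also have "\<dots> \<le> max C 0 * growth_rate z ^ m"
        using order.trans[OF abs_ge_self C[OF that]] growth_rate_ge_1[of z]
        by (intro mult_right_mono max.coboundedI1) auto
      finally show ?thesis by simp
    qed
    then show ?case by (intro exI[of _ "max C 0"] exI[of _ 0]) auto
  next
    case (Suc n)
    have K': "compact ((\<lambda>s. s + 1) ` K)"
      by (intro compact_continuous_image continuous_intros Suc.prems)
    have Re_K': "Re s > - real n" if "s \<in> (\<lambda>s. s + 1) ` K" for s
      using that Suc.prems(2) by fastforce
    from Suc.IH[OF K' Re_K'] obtain C k where C: "C \<ge> 0"
      "\<And>s m. s \<in> (\<lambda>s. s + 1) ` K \<Longrightarrow> norm (binom_sum z m s) \<le> C * real (m + 1) ^ k * growth_rate z ^ m"
      by blast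
    have "norm (binom_sum z m s) \<le> (2 * C) * real (m + 1) ^ Suc k * growth_rate z ^ m" if "s \<in> K" for s m
    proof -
      let ?b = "C * real (m + 1) ^ k * growth_rate z ^ m"
      have 1: "norm (binom_sum z m (s + 1)) \<le> ?b"
        using that by (intro C) auto
      have "norm (binom_sum z (m - 1) (s + 1)) \<le> C * real (m - 1 + 1) ^ k * growth_rate z ^ (m - 1)"
        using that by (intro C) auto
      \<comment> \<open>Truncated subtraction is harmless: \<open>m - 1 + 1\<close> is at most
        \<open>m + 1\<close> even for \<open>m = 0\<close>. Powers of the growth rate increase
        because it is at least 1.\<close>
      also have "\<dots> \<le> ?b"
        using C(1) growth_rate_ge_1[of z]
        by (intro mult_mono power_mono power_increasing) auto
      finally have 2: "norm (binom_sum z (m - 1) (s + 1)) \<le> ?b" .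
      have "binom_sum z m s = of_nat (m + 1) * binom_sum z m (s + 1) - of_nat m * binom_sum z (m - 1) (s + 1)"
        using binom_sum_diff_1[of z m "s + 1"] by simp
      then have "norm (binom_sum z m s) \<le> norm (of_nat (m + 1) * binom_sum z m (s + 1)) + norm (of_nat m * binom_sum z (m - 1) (s + 1))"
        by (simp only: norm_triangle_ineq4)
      also have "\<dots> \<le> real (m + 1) * ?b + real (m + 1) * ?b"
        unfolding norm_mult norm_of_nat using 1 2 by (intro add_mono mult_mono) auto
      finally show ?thesis by (simp add: algebra_simps)
    qed
    then show ?case using C(1) by (intro exI[of _ "2 * C"] exI[of _ "Suc k"]) auto
  qed
  from compact_imp_bounded[OF K] obtain B where B: "\<And>s. s \<in> K \<Longrightarrow> norm s \<le> B"
    by (auto simp: bounded_iff)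
  obtain n where n: "real n > B" using reals_Archimedean2 by blast
  show ?thesis
  proof (rule *[OF K])
    show "Re s > - real n" if "s \<in> K" for s
      using B[OF that] n abs_Re_le_cmod[of s] by linarith
  qed
qed

text \<open>Termwise differentiation inside the disc of convergence produces another factor
  \<open>m + 1\<close>; it needs convergence on the whole unit disc, so the induction leaves
  \<open>r\<close> arbitrary.\<close>

lemma summable_power_times_geometric:
  fixes r :: real
  assumes "\<bar>r\<bar> < 1"
  shows "summable (\<lambda>m. real (m + 1) ^ k * r ^ m)"
  using assms
proof (induction k arbitrary: r)
  case 0
  then show ?case by (simp add: summable_geometric)
next
  case (Suc k)
  have "summable (\<lambda>m. real m ^ k * x ^ m)" if "\<bar>x\<bar> < 1" for x :: real
  proof -
    have "summable (\<lambda>m. x * (real (m + 1) ^ k * x ^ m))"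
      by (intro summable_mult Suc.IH that)
    then show ?thesis
      by (subst summable_Suc_iff[symmetric]) (simp add: mult_ac add.commute)
  qed
  then have "summable (\<lambda>m. diffs (\<lambda>m. real m ^ k) m * r ^ m)"
    using Suc.prems by (intro termdiff_converges[where K = 1]) auto
  then show ?case by (simp add: diffs_def add.commute)
qed

text \<open>Half-geometric decay of the coefficients beats the growth of the binomial sums,
  because the growth rate is below 2 for every \<open>z \<noteq> 1\<close> on the unit circle.\<close>
lemma euler_series_summable_holomorphic:
  assumes z: "norm z = 1" "z \<noteq> 1"
    and a: "\<And>m. norm (a m) \<le> A * real (m + 1) ^ l / 2 ^ m"
  shows "summable (\<lambda>m. a m * binom_sum z m s)"
    and "(\<lambda>s. \<Sum>m. a m * binom_sum z m s) holomorphic_on UNIV"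
proof -
  \<comment> \<open>At \<open>m = 0\<close> the hypothesis reads
    \<open>norm (a 0) <= A\<close>.\<close>
  have A: "A \<ge> 0" using a[of 0] norm_ge_zero[of "a 0"] by (simp del: norm_ge_zero)
  have bound: "\<exists>M. summable M \<and> (\<forall>m. \<forall>s\<in>K. norm (a m * binom_sum z m s) \<le> M m)" if K: "compact K" for K
  proof -
    obtain C k where C: "C \<ge> 0"
      "\<And>s m. s \<in> K \<Longrightarrow> norm (binom_sum z m s) \<le> C * real (m + 1) ^ k * growth_rate z ^ m"
      using binom_sum_bounded_compact[OF K, where z = z] by blast
    define M where "M = (\<lambda>m. A * C * (real (m + 1) ^ (l + k) * (growth_rate z / 2) ^ m))"
    have "norm (a m * binom_sum z m s) \<le> M m" if "s \<in> K" for m s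
    proof -
      have "norm (a m * binom_sum z m s) \<le> (A * real (m + 1) ^ l / 2 ^ m) * (C * real (m + 1) ^ k * growth_rate z ^ m)"
        unfolding norm_mult using A C(1) C(2)[OF that] a by (intro mult_mono) auto
      also have "\<dots> = M m" by (simp add: M_def power_add power_divide mult_ac)
      finally show ?thesis .
    qed
    moreover have "summable M"
      unfolding M_def using growth_rate_ge_1[of z] growth_rate_less_2[OF z]
      by (intro summable_mult summable_power_times_geometric) auto
    ultimately show ?thesis by blast
  qed
  have "compact {s}" by simp
  from bound[OF this] obtain M where M: "summable M" "\<forall>m. \<forall>x\<in>{s}. norm (a m * binom_sum z m x) \<le> M m"
    by (elim exE conjE)
  show "summable (\<lambda>m. a m * binom_sum z m s)"
    by (rule summable_comparison_test'[OF M(1), where N = 0]) (use M(2) in simp)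
  show "(\<lambda>s. \<Sum>m. a m * binom_sum z m s) holomorphic_on UNIV"
  proof (rule holomorphic_uniform_sequence[where f = "\<lambda>n s. \<Sum>m<n. a m * binom_sum z m s"])
    show "(\<lambda>s. \<Sum>m<n. a m * binom_sum z m s) holomorphic_on UNIV" for n
      unfolding binom_sum_def by (intro holomorphic_intros) (auto simp del: of_nat_Suc of_nat_add)
    fix x :: complex
    from bound[OF compact_cball[of x 1]]
    obtain M where M: "summable M" "\<forall>m. \<forall>s\<in>cball x 1. norm (a m * binom_sum z m s) \<le> M m"
      by (elim exE conjE)
    have "uniform_limit (cball x 1) (\<lambda>n s. \<Sum>m<n. a m * binom_sum z m s) (\<lambda>s. \<Sum>m. a m * binom_sum z m s) sequentially"
      by (rule Weierstrass_m_test[OF _ M(1)]) (use M(2) in blast)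
    then show "\<exists>d>0. cball x d \<subseteq> UNIV \<and> uniform_limit (cball x d) (\<lambda>n s. \<Sum>m<n. a m * binom_sum z m s) (\<lambda>s. \<Sum>m. a m * binom_sum z m s) sequentially"
      by (intro exI[of _ 1]) auto
  qed auto
qed

subsection \<open>The Lerch function\<close>

lemma has_integral_Gamma_lerch_term:
  assumes s: "Re s > 0"
  shows "((\<lambda>t. of_real t powr (s - 1) * (of_real (exp (- t)) * (z * of_real (exp (- t))) ^ j))
           has_integral (Gamma s * (z ^ j / of_nat (j + 1) powr s))) {0<..}"
proof -
  have "((\<lambda>t. z ^ j * (of_real t powr (s - 1) * of_real (exp (- real (j + 1) * t))))
          has_integral (z ^ j * (Gamma (s - 1 + 1) / of_real (real (j + 1)) powr (s - 1 + 1)))) {0<..}"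
    using s by (intro has_integral_mult_right has_integral_powr_exp) auto
  also have "z ^ j * (Gamma (s - 1 + 1) / of_real (real (j + 1)) powr (s - 1 + 1)) = Gamma s * (z ^ j / of_nat (j + 1) powr s)"
    by simp
  also have "(\<lambda>t. z ^ j * (of_real t powr (s - 1) * of_real (exp (- real (j + 1) * t)))) =
     (\<lambda>t. of_real t powr (s - 1) * (of_real (exp (- t)) * (z * of_real (exp (- t))) ^ j))"
  proof
    fix t :: real
    have "exp (- real (j + 1) * t) = exp (- t) * exp (- t) ^ j"
      by (simp add: exp_of_nat_mult[symmetric] exp_add[symmetric] algebra_simps)
    then have e: "complex_of_real (exp (- real (j + 1) * t)) = of_real (exp (- t)) * of_real (exp (- t)) ^ j"
      by simp
    show "z ^ j * (of_real t powr (s - 1) * of_real (exp (- real (j + 1) * t))) =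
      of_real t powr (s - 1) * (of_real (exp (- t)) * (z * of_real (exp (- t))) ^ j)"
      unfolding e by (simp add: power_mult_distrib mult_ac)
  qed
  finally show ?thesis .
qed

text \<open>The Euler transform of the series of \<open>z ^ j / (j + 1) powr s\<close>. It converges
  for all \<open>s\<close> when \<open>z\<close> is on the unit circle and not 1, so the analytic
  continuation is built into the definition.\<close>

definition lerch :: "complex \<Rightarrow> complex \<Rightarrow> complex" where
  "lerch z s = (\<Sum>m. 1 / 2 ^ Suc m * binom_sum z m s)"

lemma norm_half_power_le: "norm (1 / 2 ^ Suc m :: complex) \<le> 1 * real (m + 1) ^ 0 / 2 ^ m"
  by (simp add: norm_divide norm_power norm_mult divide_simps)

lemma lerch_holomorphic:
  assumes "norm z = 1" "z \<noteq> 1"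
  shows "lerch z holomorphic_on UNIV"
  unfolding lerch_def
  by (rule euler_series_summable_holomorphic(2)[OF assms norm_half_power_le])

text \<open>Reverse triangle inequality for \<open>2 - (1 + z * r)\<close>. It keeps the geometric
  series with ratio \<open>z * exp (- t)\<close> under control as \<open>t\<close> tends to
  0.\<close>

lemma norm_one_minus_mult_ge:
  assumes "0 \<le> r" "r \<le> 1"
  shows "norm (1 - z * of_real r) \<ge> 2 - growth_rate z"
  using norm_triangle_ineq2[of 2 "1 + z * of_real r"] norm_one_plus_mult_le_growth_rate[OF assms, of z]
  by simp

text \<open>Up to the factor \<open>\<Gamma>(s)\<close>, both the Dirichlet series and its Euler transform are the
  integral of \<open>t\<^sup>s\<^sup>-\<^sup>1 e\<^sup>-\<^sup>t\<close> against a geometric series with sum \<open>1 / (1 - z e\<^sup>-\<^sup>t)\<close>.\<close>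
lemma lerch_sums:
  assumes z: "norm z = 1" "z \<noteq> 1" and s: "Re s > 0"
  shows "(\<lambda>j. z ^ j / of_nat (j + 1) powr s) sums lerch z s"
proof -
  define d where "d = 2 - growth_rate z"
  have d: "d > 0" using growth_rate_less_2[OF z] by (simp add: d_def)
  have rho: "growth_rate z \<ge> 1" by (rule growth_rate_ge_1)
  have s': "Re (s - 1) > -1" using s by simp
  have Gs: "Gamma s \<noteq> 0" using Gamma_plus_1_nonzero[OF s'] by simp
  define v where "v = (\<lambda>t. complex_of_real (exp (- t)) * (1 / (1 - z * of_real (exp (- t)))))"
  have den: "norm (1 - z * of_real (exp (- t))) \<ge> d" if "t > 0" for t
    unfolding d_def using that by (intro norm_one_minus_mult_ge) auto
  have den0: "1 - z * of_real (exp (- t)) \<noteq> 0" if "t > 0" for t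
    using den[OF that] d by auto

  \<comment> \<open>First evaluation of the integral of \<open>v\<close>, through the partial sums
    of the Dirichlet series. The constant \<open>2 / d\<close> bounds
    \<open>(1 - w ^ n) / (1 - w)\<close>, since \<open>norm w < 1\<close>.\<close>
  have "(\<lambda>n. integral {0<..} (\<lambda>t. of_real t powr (s - 1) * (of_real (exp (- t)) * (\<Sum>j<n. (z * of_real (exp (- t))) ^ j))))
          \<longlonglongrightarrow> integral {0<..} (\<lambda>t. of_real t powr (s - 1) * v t)"
  proof (rule integral_powr_exp_tendsto[OF s'])
    show "continuous_on {0<..} (\<lambda>t. of_real (exp (- t)) * (\<Sum>j<n. (z * of_real (exp (- t))) ^ j))" for n
      by (intro continuous_intros)
    fix t :: real assume t: "t > 0"
    let ?w = "z * of_real (exp (- t))"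
    have w: "norm ?w < 1" using z t by (simp add: norm_mult)
    show "(\<lambda>n. of_real (exp (- t)) * (\<Sum>j<n. ?w ^ j)) \<longlonglongrightarrow> v t"
      unfolding v_def using geometric_sums[OF w] by (intro tendsto_intros) (simp add: sums_def)
    show "norm (of_real (exp (- t)) * (\<Sum>j<n. ?w ^ j)) \<le> (2 / d) * exp (- t)" for n
    proof -
      have "norm (\<Sum>j<n. ?w ^ j) = norm (1 - ?w ^ n) / norm (1 - ?w)"
        using den0[OF t] by (subst sum_gp_strict) (auto simp: norm_divide)
      also have "\<dots> \<le> 2 / d"
      proof (rule frac_le)
        have "norm (1 - ?w ^ n) \<le> 1 + norm ?w ^ n"
          using norm_triangle_ineq4[of 1 "?w ^ n"] by (simp add: norm_power)
        also have "norm ?w ^ n \<le> 1"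
          using w by (intro power_le_one) auto
        finally show "norm (1 - ?w ^ n) \<le> 2" by simp
      qed (use den[OF t] d in auto)
      finally have "norm (of_real (exp (- t)) :: complex) * norm (\<Sum>j<n. ?w ^ j) \<le> exp (- t) * (2 / d)"
        by (intro mult_mono) auto
      then show ?thesis
        by (simp only: norm_mult mult.commute)
    qed
  qed
  moreover have "integral {0<..} (\<lambda>t. of_real t powr (s - 1) * (of_real (exp (- t)) * (\<Sum>j<n. (z * of_real (exp (- t))) ^ j)))
      = Gamma s * (\<Sum>j<n. z ^ j / of_nat (j + 1) powr s)" for n
  proof (rule integral_unique)
    have "((\<lambda>t. \<Sum>j<n. of_real t powr (s - 1) * (of_real (exp (- t)) * (z * of_real (exp (- t))) ^ j))
           has_integral (\<Sum>j<n. Gamma s * (z ^ j / of_nat (j + 1) powr s))) {0<..}"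
      by (intro has_integral_sum has_integral_Gamma_lerch_term s) auto
    then show "((\<lambda>t. of_real t powr (s - 1) * (of_real (exp (- t)) * (\<Sum>j<n. (z * of_real (exp (- t))) ^ j)))
      has_integral Gamma s * (\<Sum>j<n. z ^ j / of_nat (j + 1) powr s)) {0<..}"
      by (simp only: sum_distrib_left)
  qed
  ultimately have 1: "(\<lambda>n. Gamma s * (\<Sum>j<n. z ^ j / of_nat (j + 1) powr s))
      \<longlonglongrightarrow> integral {0<..} (\<lambda>t. of_real t powr (s - 1) * v t)"
    by simp

  \<comment> \<open>Second evaluation of the same integral, through the Euler transform. The
    constant \<open>1 / d\<close> is the sum of the majorizing geometric series with ratio
    \<open>growth_rate z / 2\<close>.\<close>
  have "(\<lambda>n. integral {0<..} (\<lambda>t. of_real t powr (s - 1) * (of_real (exp (- t)) *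
            (\<Sum>m<n. 1 / 2 ^ Suc m * (1 + z * of_real (exp (- t))) ^ m))))
          \<longlonglongrightarrow> integral {0<..} (\<lambda>t. of_real t powr (s - 1) * v t)"
  proof (rule integral_powr_exp_tendsto[OF s'])
    show "continuous_on {0<..} (\<lambda>t. of_real (exp (- t)) * (\<Sum>m<n. 1 / 2 ^ Suc m * (1 + z * of_real (exp (- t))) ^ m))" for n
      by (intro continuous_intros) auto
    fix t :: real assume t: "t > 0"
    let ?w = "1 + z * of_real (exp (- t))"
    have w: "norm ?w \<le> growth_rate z"
      using t by (intro norm_one_plus_mult_le_growth_rate) auto
    then have "norm (?w / 2) < 1"
      using d by (simp add: d_def norm_divide)
    from sums_mult[OF geometric_sums[OF this], of "1 / 2"]
    have "(\<lambda>m. 1 / 2 ^ Suc m * ?w ^ m) sums (1 / 2 * (1 / (1 - ?w / 2)))"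
      by (simp add: power_divide)
    also have "1 / 2 * (1 / (1 - ?w / 2)) = 1 / (1 - z * of_real (exp (- t)))"
      using den0[OF t] by (simp add: field_simps)
    finally show "(\<lambda>n. of_real (exp (- t)) * (\<Sum>m<n. 1 / 2 ^ Suc m * ?w ^ m)) \<longlonglongrightarrow> v t"
      unfolding v_def by (intro tendsto_intros) (simp add: sums_def)
    show "norm (of_real (exp (- t)) * (\<Sum>m<n. 1 / 2 ^ Suc m * ?w ^ m)) \<le> (1 / d) * exp (- t)" for n
    proof -
      have "norm (\<Sum>m<n. 1 / 2 ^ Suc m * ?w ^ m) \<le> (\<Sum>m<n. 1 / 2 * (growth_rate z / 2) ^ m)"
      proof (rule sum_norm_le)
        fix m
        have "norm (1 / 2 ^ Suc m * ?w ^ m) = 1 / 2 ^ Suc m * norm ?w ^ m"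
          by (simp add: norm_mult norm_divide norm_power)
        also have "\<dots> \<le> 1 / 2 ^ Suc m * growth_rate z ^ m"
          using w by (intro mult_left_mono power_mono) auto
        finally show "norm (1 / 2 ^ Suc m * ?w ^ m) \<le> 1 / 2 * (growth_rate z / 2) ^ m"
          by (simp add: power_divide)
      qed
      also have "\<dots> \<le> 1 / d"
      proof -
        have "\<bar>growth_rate z / 2\<bar> < 1" using d rho by (simp add: d_def)
        from sums_mult[OF geometric_sums, of "growth_rate z / 2" "1/2"] this
        have *: "(\<lambda>m. 1 / 2 * (growth_rate z / 2) ^ m) sums (1 / 2 * (1 / (1 - growth_rate z / 2)))"
          by simp
        have "(\<Sum>m<n. 1 / 2 * (growth_rate z / 2) ^ m) \<le> 1 / 2 * (1 / (1 - growth_rate z / 2))"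
          unfolding sums_unique[OF *] using rho by (intro sum_le_suminf sums_summable[OF *]) auto
        also have "\<dots> = 1 / d"
          using d by (simp add: d_def field_simps)
        finally show ?thesis .
      qed
      finally have "norm (of_real (exp (- t)) :: complex) * norm (\<Sum>m<n. 1 / 2 ^ Suc m * ?w ^ m) \<le> exp (- t) * (1 / d)"
        by (intro mult_mono) auto
      then show ?thesis
        by (simp only: norm_mult mult.commute)
    qed
  qed
  moreover have "integral {0<..} (\<lambda>t. of_real t powr (s - 1) * (of_real (exp (- t)) *
            (\<Sum>m<n. 1 / 2 ^ Suc m * (1 + z * of_real (exp (- t))) ^ m)))
      = Gamma s * (\<Sum>m<n. 1 / 2 ^ Suc m * binom_sum z m s)" for n
  proof (rule integral_unique)
    have "((\<lambda>t. \<Sum>m<n. 1 / 2 ^ Suc m * (of_real t powr (s - 1) * (of_real (exp (- t)) * (1 + z * of_real (exp (- t))) ^ m)))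
           has_integral (\<Sum>m<n. 1 / 2 ^ Suc m * (Gamma s * binom_sum z m s))) {0<..}"
      by (intro has_integral_sum has_integral_mult_right has_integral_Gamma_binom_sum s) auto
    then show "((\<lambda>t. of_real t powr (s - 1) * (of_real (exp (- t)) *
            (\<Sum>m<n. 1 / 2 ^ Suc m * (1 + z * of_real (exp (- t))) ^ m)))
      has_integral Gamma s * (\<Sum>m<n. 1 / 2 ^ Suc m * binom_sum z m s)) {0<..}"
      by (simp only: sum_distrib_left mult_ac)
  qed
  ultimately have 2: "(\<lambda>n. Gamma s * (\<Sum>m<n. 1 / 2 ^ Suc m * binom_sum z m s))
      \<longlonglongrightarrow> integral {0<..} (\<lambda>t. of_real t powr (s - 1) * v t)"
    by simp
  have "(\<lambda>m. 1 / 2 ^ Suc m * binom_sum z m s) sums lerch z s"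
    unfolding lerch_def
    by (intro summable_sums euler_series_summable_holomorphic(1)[OF z norm_half_power_le])
  then have "(\<lambda>n. Gamma s * (\<Sum>m<n. 1 / 2 ^ Suc m * binom_sum z m s)) \<longlonglongrightarrow> Gamma s * lerch z s"
    unfolding sums_def by (intro tendsto_intros)
  from LIMSEQ_unique[OF 2 this] 1
  have "(\<lambda>n. Gamma s * (\<Sum>j<n. z ^ j / of_nat (j + 1) powr s)) \<longlonglongrightarrow> Gamma s * lerch z s"
    by simp
  from tendsto_mult[OF tendsto_const[of "1 / Gamma s"] this]
  show ?thesis
    using Gs by (simp add: sums_def)
qed

text \<open>The column bounds \<open>M j\<close> make the family absolutely summable over all pairs,
  so Fubini applies; by triangularity each row sum is finite.\<close>

lemma triangular_double_sums_swap:
  fixes f :: "nat \<Rightarrow> nat \<Rightarrow> complex"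
  assumes r: "\<And>j. (\<lambda>m. f m j) sums r j"
    and bd: "\<And>j n. (\<Sum>m<n. norm (f m j)) \<le> M j" and M: "summable M"
    and tri: "\<And>m j. j > m \<Longrightarrow> f m j = 0"
    and R: "r sums R"
  shows "(\<lambda>m. \<Sum>j=0..m. f m j) sums R"
proof -
  have sn: "summable (\<lambda>m. norm (f m j))" for j
    by (rule summableI_nonneg_bounded[OF _ bd]) auto
  have hs: "((\<lambda>m. norm (f m j)) has_sum (\<Sum>m. norm (f m j))) UNIV" for j
    using sn by (intro norm_summable_imp_has_sum) auto
  have le: "(\<Sum>m. norm (f m j)) \<le> M j" for j
    by (rule suminf_le_const[OF sn bd])
  have "(\<lambda>(j, m). norm (f m j)) summable_on UNIV \<times> UNIV"
  proof (rule summable_on_SigmaI[where g = "\<lambda>j. \<Sum>m. norm (f m j)"])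
    have "summable (\<lambda>j. norm (\<Sum>m. norm (f m j)))"
      by (rule summable_comparison_test'[OF M, where N = 0]) (use le sn in \<open>simp add: suminf_nonneg\<close>)
    then show "(\<lambda>j. \<Sum>m. norm (f m j)) summable_on UNIV"
      by (rule norm_summable_imp_summable_on)
  qed (use hs in auto)
  then have "(\<lambda>p. norm (case p of (j, m) \<Rightarrow> f m j)) summable_on UNIV \<times> UNIV"
    by (simp add: case_prod_unfold)
  then have "(\<lambda>(j, m). f m j) summable_on UNIV \<times> UNIV"
    by (rule abs_summable_summable)
  then obtain S where S: "((\<lambda>(j, m). f m j) has_sum S) (UNIV \<times> UNIV)"
    by (auto simp: summable_on_def)
  have "(r has_sum S) UNIV"
    by (rule has_sum_SigmaD[OF S]) (use r sn in \<open>auto intro: norm_summable_imp_has_sum\<close>)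
  then have "S = R"
    using R has_sum_imp_sums sums_unique2 by blast
  have S': "((\<lambda>(m, j). f m j) has_sum S) (UNIV \<times> UNIV)"
    using S by (subst (asm) has_sum_swap) simp
  have fin: "((\<lambda>j. f m j) has_sum (\<Sum>j=0..m. f m j)) UNIV" for m
    by (rule has_sum_finite_neutralI[where B = "{0..m}"]) (use tri[of m] in auto)
  have "((\<lambda>m. \<Sum>j=0..m. f m j) has_sum S) UNIV"
    by (rule has_sum_SigmaD[OF S']) (use fin in auto)
  with \<open>S = R\<close> show ?thesis
    using has_sum_imp_sums by blast
qed

text \<open>For fixed \<open>s0\<close> both sides are entire in \<open>s\<close>, so it suffices to
  compare them where \<open>Re (s + s0) > 1\<close>. There the Dirichlet series converges absolutely
  and supplies the summable column bounds.\<close>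

lemma euler_series_sums_lerch:
  assumes z: "norm z = 1" "z \<noteq> 1" and s0: "Re s0 > -1"
  shows "(\<lambda>m. euler_coeff m s0 * binom_sum z m s) sums lerch z (s + s0)"
proof -
  define A where "A = Gamma (Re s0 + 1) / norm (Gamma (s0 + 1))"
  have bound: "norm (euler_coeff m s0) \<le> A * real (m + 1) ^ 1 / 2 ^ m" for m
    using norm_euler_coeff_le[OF s0, of m] by (simp add: A_def)
  define F where "F = (\<lambda>s. \<Sum>m. euler_coeff m s0 * binom_sum z m s)"
  have F_sums: "(\<lambda>m. euler_coeff m s0 * binom_sum z m s) sums F s" for s
    unfolding F_def by (intro summable_sums euler_series_summable_holomorphic(1)[OF z bound])
  have "F s = lerch z (s + s0)"
  proof (rule analytic_continuation_open[where s = "{s. Re s > 1 - Re s0}" and s' = UNIV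
      and f = F and g = "\<lambda>s. lerch z (s + s0)"])
    show "F holomorphic_on UNIV"
      unfolding F_def by (rule euler_series_summable_holomorphic(2)[OF z bound])
    have "(lerch z \<circ> (\<lambda>s. s + s0)) holomorphic_on UNIV"
      by (rule holomorphic_on_compose_gen[OF _ lerch_holomorphic[OF z]]) (auto intro!: holomorphic_intros)
    then show "(\<lambda>s. lerch z (s + s0)) holomorphic_on UNIV"
      by (simp add: o_def)
    show "open {s. Re s > 1 - Re s0}"
      by (rule open_halfspace_Re_gt)
    show "{s. Re s > 1 - Re s0} \<noteq> {}"
      by (auto intro!: exI[of _ "of_real (2 - Re s0)"])
    fix s assume "s \<in> {s. Re s > 1 - Re s0}"
    then have s: "Re (s + s0) > 1" by simp
    define c where "c = (\<lambda>j. z ^ j / of_nat (j + 1) powr s)"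
    have norm_c: "norm (c j) = real (j + 1) powr (- Re s)" for j
    proof -
      have "norm (complex_of_real (real (j + 1)) powr s) = real (j + 1) powr Re s"
        by (rule norm_of_real_powr) auto
      then show ?thesis
        using z by (simp add: c_def norm_divide norm_power powr_minus inverse_eq_divide)
    qed
    have "(\<lambda>m. \<Sum>j=0..m. of_nat (m choose j) * euler_coeff m s0 * c j) sums lerch z (s + s0)"
    proof (rule triangular_double_sums_swap)
      show "(\<lambda>m. of_nat (m choose j) * euler_coeff m s0 * c j) sums (1 / of_nat (j + 1) powr s0 * c j)" for j
        by (intro sums_mult2 euler_coeff_binomial_sums s0)
      show "(\<Sum>m<n. norm (of_nat (m choose j) * euler_coeff m s0 * c j)) \<le> A * real (j + 1) powr (- Re (s + s0))" for j n
      proof -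
        have "(\<Sum>m<n. norm (of_nat (m choose j) * euler_coeff m s0 * c j)) =
              (\<Sum>m<n. real (m choose j) * norm (euler_coeff m s0)) * real (j + 1) powr (- Re s)"
          by (simp only: norm_mult norm_of_nat norm_c sum_distrib_right)
        also have "\<dots> \<le> A * real (j + 1) powr (- Re s0) * real (j + 1) powr (- Re s)"
          unfolding A_def by (intro mult_right_mono sum_binomial_norm_euler_coeff_le s0) auto
        also have "\<dots> = A * real (j + 1) powr (- Re (s + s0))"
          by (simp add: powr_add[symmetric] mult.assoc algebra_simps)
        finally show ?thesis .
      qed
      have "summable (\<lambda>j. real j powr (- Re (s + s0)))"
        using s by (subst summable_real_powr_iff) auto
      then have "summable (\<lambda>j. real (j + 1) powr (- Re (s + s0)))"
        by (subst (asm) summable_Suc_iff[symmetric]) (simp add: add.commute)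
      then show "summable (\<lambda>j. A * real (j + 1) powr (- Re (s + s0)))"
        by (rule summable_mult)
      have "(\<lambda>j. 1 / of_nat (j + 1) powr s0 * c j) = (\<lambda>j. z ^ j / of_nat (j + 1) powr (s + s0))"
        unfolding c_def powr_add by (simp add: fun_eq_iff mult_ac)
      then show "(\<lambda>j. 1 / of_nat (j + 1) powr s0 * c j) sums lerch z (s + s0)"
        using lerch_sums[OF z, of "s + s0"] s by simp
    qed (simp add: binomial_eq_0)
    also have "(\<lambda>m. \<Sum>j=0..m. of_nat (m choose j) * euler_coeff m s0 * c j) =
               (\<lambda>m. euler_coeff m s0 * binom_sum z m s)"
      by (simp add: binom_sum_def c_def sum_distrib_left mult_ac fun_eq_iff)
    finally show "F s = lerch z (s + s0)"
      using F_sums sums_unique2 by blast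
  qed auto
  with F_sums[of s] show ?thesis by simp
qed

subsection \<open>Coefficients of the Stirling formula\<close>

lemma holomorphic_eq_if_eq_on_halfplane:
  assumes "f holomorphic_on UNIV" "g holomorphic_on UNIV" "\<And>s. Re s > c \<Longrightarrow> f s = g s"
  shows "f = g"
proof
  fix s
  show "f s = g s"
  proof (rule analytic_continuation_open[where s = "{s. Re s > c}" and s' = UNIV and f = f and g = g])
    show "{s. Re s > c} \<noteq> {}"
      by (auto intro!: exI[of _ "of_real (c + 1)"])
  qed (use assms open_halfspace_Re_gt in auto)
qed

text \<open>The Lerch function at -1 provides existence, and the identity theorem on
  \<open>Re s > 0\<close> uniqueness, so the definite description denotes it.\<close>

lemma dirichlet_eta_eq_lerch: "dirichlet_eta = lerch (-1)"
  unfolding dirichlet_eta_def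
proof (rule the_equality)
  have sums: "(\<lambda>n. (-1) ^ n / of_nat (Suc n) powr s) sums lerch (-1) s" if "Re s > 0" for s
    using lerch_sums[of "-1" s] that by simp
  then show "lerch (-1) holomorphic_on UNIV \<and>
      (\<forall>s. 0 < Re s \<longrightarrow> (\<lambda>n. (-1) ^ n / of_nat (Suc n) powr s) sums lerch (-1) s)"
    using lerch_holomorphic[of "-1"] by auto
  fix f assume f: "f holomorphic_on UNIV \<and>
      (\<forall>s. 0 < Re s \<longrightarrow> (\<lambda>n. (-1) ^ n / of_nat (Suc n) powr s) sums f s)"
  show "f = lerch (-1)"
  proof (rule holomorphic_eq_if_eq_on_halfplane)
    show "f s = lerch (-1) s" if "Re s > 0" for s
      using f sums[OF that] that sums_unique2 by blast
  qed (use f lerch_holomorphic[of "-1"] in auto)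
qed

text \<open>The falling factorial of \<open>j + 1\<close> with \<open>m + 1\<close> factors is
  \<open>fact (m + 1)\<close> times \<open>(j + 1) choose (m + 1)\<close>; absorption finishes. The
  term \<open>l = 0\<close> vanishes.\<close>

lemma sum_signed_stirling_power:
  "(\<Sum>l=1..m+1. of_int (signed_stirling (m + 1) l) * of_nat (j + 1) ^ l) =
     (of_nat (j + 1) * fact m * of_nat (j choose m) :: complex)"
proof -
  let ?x = "of_nat (Suc j) :: complex"
  have "(\<Sum>l=1..m+1. of_int (signed_stirling (m + 1) l) * of_nat (j + 1) ^ l) =
        (\<Sum>l\<le>Suc m. of_int (signed_stirling (Suc m) l) * ?x ^ l)"
    by (rule sum.mono_neutral_cong_left) (auto simp: signed_stirling_def not_less_eq_eq)
  \<comment> \<open>Moving the signs into the argument turns the falling factorial of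
    \<open>?x\<close> into the rising factorial of \<open>- ?x\<close>, which unsigned Stirling
    numbers expand.\<close>
  also have "\<dots> = (\<Sum>l\<le>Suc m. (-1) ^ Suc m * (of_nat (stirling (Suc m) l) * (- ?x) ^ l))"
  proof (rule sum.cong[OF refl])
    fix l assume "l \<in> {..Suc m}"
    then have "(-1) ^ (Suc m - l) = (-1) ^ Suc m * ((-1) ^ l :: complex)"
      by (auto simp: power_diff_conv_inverse minus_one_power_iff)
    then show "of_int (signed_stirling (Suc m) l) * ?x ^ l = (-1) ^ Suc m * (of_nat (stirling (Suc m) l) * (- ?x) ^ l)"
      unfolding signed_stirling_def power_minus[of ?x] by (simp add: mult_ac)
  qed
  also have "\<dots> = (-1) ^ Suc m * pochhammer (- ?x) (Suc m)"
    by (simp only: sum_distrib_left[symmetric] stirling_pochhammer)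
  also have "\<dots> = fact (Suc m) * (?x gchoose Suc m)"
    unfolding gbinomial_pochhammer by (simp del: fact_Suc)
  also have "?x gchoose Suc m = of_nat (Suc j choose Suc m)"
    by (rule binomial_gbinomial[symmetric])
  also have "fact (Suc m) * (of_nat (Suc j choose Suc m) :: complex) = fact m * of_nat (Suc m * (Suc j choose Suc m))"
    by (simp only: fact_Suc of_nat_mult mult_ac)
  also have "Suc m * (Suc j choose Suc m) = Suc j * (j choose m)"
    by (rule Suc_times_binomial)
  finally show ?thesis by (simp only: of_nat_mult Suc_eq_plus1 mult_ac)
qed

text \<open>Rewriting \<open>(k choose j) * (j choose m)\<close> as
  \<open>(k choose m) * ((k - m) choose (j - m))\<close> leaves an alternating row sum, which
  vanishes unless \<open>k = m\<close>.\<close>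

lemma alternating_binomial_orthogonality:
  "(\<Sum>j=0..k. (-1) ^ j * of_nat (k choose j) * of_nat (j choose m)) =
     (if k = m then (-1) ^ m else 0 :: complex)"
proof (cases "m \<le> k")
  case False
  then show ?thesis by (auto intro!: sum.neutral simp: binomial_eq_0)
next
  case True
  have "(\<Sum>j=0..k. (-1) ^ j * of_nat (k choose j) * of_nat (j choose m)) =
        (\<Sum>j=m..k. (-1) ^ j * of_nat (k choose j) * of_nat (j choose m) :: complex)"
    by (rule sum.mono_neutral_right) (auto simp: binomial_eq_0)
  also have "\<dots> = (\<Sum>i\<le>k-m. (-1) ^ m * of_nat (k choose m) * ((-1) ^ i * of_nat ((k - m) choose i)))"
  proof (rule sum.reindex_bij_witness[where i = "\<lambda>i. i + m" and j = "\<lambda>j. j - m"])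
    fix j assume j: "j \<in> {m..k}"
    then have "(k choose j) * (j choose m) = (k choose m) * ((k - m) choose (j - m))"
      by (intro choose_mult) auto
    then have "of_nat (k choose j) * of_nat (j choose m) = (of_nat (k choose m) * of_nat ((k - m) choose (j - m)) :: complex)"
      by (simp only: of_nat_mult[symmetric])
    moreover have "(-1) ^ j = (-1) ^ m * ((-1) ^ (j - m) :: complex)"
      using j by (simp flip: power_add)
    ultimately show "(-1) ^ m * of_nat (k choose m) * ((-1) ^ (j - m) * of_nat ((k - m) choose (j - m))) =
        ((-1) ^ j * of_nat (k choose j) * of_nat (j choose m) :: complex)"
      by (simp add: mult_ac)
  qed (use True in auto)
  also have "\<dots> = (-1) ^ m * of_nat (k choose m) * (\<Sum>i\<le>k-m. (-1) ^ i * of_nat ((k - m) choose i))"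
    by (simp only: sum_distrib_left)
  also have "\<dots> = (if k = m then (-1) ^ m else 0)"
    using True choose_alternating_sum[of "k - m", where 'a = complex] by auto
  finally show ?thesis .
qed

text \<open>A finite combination of values of an entire function, hence meaningful for every
  \<open>s\<close>; it continues \<open>euler_coeff\<close> beyond \<open>Re s > -1\<close>.\<close>

definition eta_coeff :: "nat \<Rightarrow> complex \<Rightarrow> complex" where
  "eta_coeff m s = (-1) ^ m / fact m *
     (\<Sum>l=1..m+1. of_int (signed_stirling (m + 1) l) * dirichlet_eta (s + 1 - of_nat l))"

text \<open>Expanding each \<open>\<eta>(s + 1 - l)\<close> in the Euler series with \<open>z = -1\<close>, the Stirling numbers
  turn the powers \<open>(j + 1)\<^sup>l\<^sup>-\<^sup>1\<close> into binomial coefficients, and binomial inversion leaves only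
  the \<open>m\<close>-th term.\<close>
lemma eta_coeff_eq_euler_coeff:
  assumes s: "Re s > -1"
  shows "eta_coeff m s = euler_coeff m s"
proof -
  let ?S = "\<lambda>l. of_int (signed_stirling (m + 1) l) :: complex"
  have "(\<lambda>k. \<Sum>l=1..m+1. ?S l * (euler_coeff k s * binom_sum (-1) k (1 - of_nat l))) sums
          (\<Sum>l=1..m+1. ?S l * lerch (-1) (1 - of_nat l + s))"
    by (intro sums_sum sums_mult euler_series_sums_lerch s) auto
  also have "(\<lambda>k. \<Sum>l=1..m+1. ?S l * (euler_coeff k s * binom_sum (-1) k (1 - of_nat l))) =
             (\<lambda>k. if k = m then (-1) ^ m * fact m * euler_coeff k s else 0)"
  proof
    fix k
    have "(\<Sum>l=1..m+1. ?S l * binom_sum (-1) k (1 - of_nat l)) =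
          (\<Sum>l=1..m+1. \<Sum>j=0..k. (-1) ^ j * of_nat (k choose j) / of_nat (j + 1) * (?S l * of_nat (j + 1) ^ l))"
      unfolding binom_sum_def sum_distrib_left
    proof (intro sum.cong refl)
      fix l j
      have "of_nat (j + 1) powr (1 - of_nat l) = (of_nat (j + 1) / of_nat (j + 1) ^ l :: complex)"
        unfolding powr_diff by (subst powr_nat) (simp_all del: of_nat_Suc of_nat_add)
      then show "?S l * ((-1) ^ j * of_nat (k choose j) / of_nat (j + 1) powr (1 - of_nat l)) =
          (-1) ^ j * of_nat (k choose j) / of_nat (j + 1) * (?S l * of_nat (j + 1) ^ l)"
        by (simp only: divide_divide_eq_right) (simp add: mult_ac del: of_nat_Suc of_nat_add)
    qed
    also have "\<dots> = (\<Sum>j=0..k. (-1) ^ j * of_nat (k choose j) / of_nat (j + 1) * (\<Sum>l=1..m+1. ?S l * of_nat (j + 1) ^ l))"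
      by (subst sum.swap) (simp only: sum_distrib_left)
    also have "\<dots> = (\<Sum>j=0..k. fact m * ((-1) ^ j * of_nat (k choose j) * of_nat (j choose m)))"
      unfolding sum_signed_stirling_power
      by (intro sum.cong refl) (simp add: mult_ac del: of_nat_Suc of_nat_add)
    also have "\<dots> = fact m * (if k = m then (-1) ^ m else 0)"
      by (simp only: sum_distrib_left[symmetric] alternating_binomial_orthogonality)
    finally have "(\<Sum>l=1..m+1. ?S l * binom_sum (-1) k (1 - of_nat l)) = fact m * (if k = m then (-1) ^ m else 0)" .
    then have "euler_coeff k s * (\<Sum>l=1..m+1. ?S l * binom_sum (-1) k (1 - of_nat l)) =
        (if k = m then (-1) ^ m * fact m * euler_coeff k s else 0)"
      by simp
    then show "(\<Sum>l=1..m+1. ?S l * (euler_coeff k s * binom_sum (-1) k (1 - of_nat l))) =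
        (if k = m then (-1) ^ m * fact m * euler_coeff k s else 0)"
      by (simp only: sum_distrib_left mult_ac)
  qed
  finally have *: "(\<lambda>k. if k = m then (-1) ^ m * fact m * euler_coeff k s else 0) sums
      (\<Sum>l=1..m+1. ?S l * lerch (-1) (1 - of_nat l + s))" .
  have "(\<Sum>l=1..m+1. ?S l * lerch (-1) (1 - of_nat l + s)) = (-1) ^ m * fact m * euler_coeff m s"
    by (rule sums_unique2[OF * sums_single])
  moreover have "(1 - of_nat l + s) = s + 1 - of_nat l" for l by simp
  ultimately show ?thesis
    unfolding eta_coeff_def dirichlet_eta_eq_lerch by simp
qed

lemma signed_stirling_Suc_Suc:
  "signed_stirling (Suc n) (Suc k) = signed_stirling n k - int n * signed_stirling n (Suc k)"
proof (cases "k < n")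
  case True
  then have "n - k = Suc (n - Suc k)" by simp
  then show ?thesis by (simp add: signed_stirling_def algebra_simps)
next
  \<comment> \<open>Here \<open>stirling n (Suc k)\<close> is 0, and truncated subtraction makes the
    remaining sign exponents 0.\<close>
  case False
  then show ?thesis by (simp add: signed_stirling_def)
qed

text \<open>In the Stirling recurrence the part with lowered second index, after shifting
  \<open>l\<close>, has eta evaluated one unit further left, which is the sum for
  \<open>s - 1\<close>.\<close>

lemma eta_coeff_diff_1:
  "eta_coeff m (s - 1) = of_nat (m + 1) * (eta_coeff m s - eta_coeff (Suc m) s)"
proof -
  let ?S = "\<lambda>n l. of_int (signed_stirling n l) :: complex"
  let ?e = "\<lambda>l. dirichlet_eta (s + 1 - of_nat l)"
  have "(\<Sum>l=1..Suc m+1. ?S (Suc m + 1) l * ?e l) = (\<Sum>l=0..m+1. ?S (Suc (Suc m)) (Suc l) * ?e (Suc l))"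
    using sum.shift_bounds_cl_Suc_ivl[of "\<lambda>l. ?S (Suc (Suc m)) l * ?e l" 0 "Suc m"] by simp
  also have "\<dots> = (\<Sum>l=0..m+1. ?S (Suc m) l * ?e (Suc l)) - of_nat (Suc m) * (\<Sum>l=0..m+1. ?S (Suc m) (Suc l) * ?e (Suc l))"
    by (simp only: signed_stirling_Suc_Suc sum_distrib_left sum_subtractf[symmetric])
       (intro sum.cong refl, simp add: algebra_simps)
  also have "(\<Sum>l=0..m+1. ?S (Suc m) l * ?e (Suc l)) = (\<Sum>l=1..m+1. ?S (m + 1) l * dirichlet_eta (s - 1 + 1 - of_nat l))"
    by (rule sum.mono_neutral_cong_right) (auto simp: signed_stirling_def not_less_eq_eq algebra_simps)
  also have "(\<Sum>l=0..m+1. ?S (Suc m) (Suc l) * ?e (Suc l)) = (\<Sum>l=Suc 0..Suc (m+1). ?S (Suc m) l * ?e l)"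
    by (rule sum.shift_bounds_cl_Suc_ivl[symmetric])
  also have "\<dots> = (\<Sum>l=1..m+1. ?S (m + 1) l * ?e l)"
    by (simp add: signed_stirling_def)
  finally have *: "(\<Sum>l=1..Suc m+1. ?S (Suc m + 1) l * ?e l) =
      (\<Sum>l=1..m+1. ?S (m + 1) l * dirichlet_eta (s - 1 + 1 - of_nat l)) - of_nat (Suc m) * (\<Sum>l=1..m+1. ?S (m + 1) l * ?e l)" .
  have f: "of_nat (m + 1) / (fact (Suc m) :: complex) = 1 / fact m"
    unfolding fact_Suc by (simp del: of_nat_Suc of_nat_add)
  have "of_nat (m + 1) * eta_coeff (Suc m) s =
      (-1) ^ Suc m * (of_nat (m + 1) / fact (Suc m)) * (\<Sum>l=1..Suc m+1. ?S (Suc m + 1) l * ?e l)"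
    unfolding eta_coeff_def by (simp only: times_divide_eq_left times_divide_eq_right mult_ac)
  also have "\<dots> = of_nat (m + 1) * eta_coeff m s - eta_coeff m (s - 1)"
  proof -
    have "(-1) ^ Suc m * (1 / fact m) * (X - of_nat (Suc m) * Y) =
        of_nat (m + 1) * ((-1) ^ m / fact m * Y) - (-1) ^ m / fact m * X" for X Y :: complex
      by (simp add: field_simps)
    then show ?thesis
      unfolding f * eta_coeff_def .
  qed
  finally show ?thesis by (simp add: algebra_simps)
qed

text \<open>For \<open>Re s > -1\<close> this is the decay of the integral coefficients. Moving one
  unit left with \<open>eta_coeff_diff_1\<close> costs one power of \<open>m + 1\<close>.\<close>

lemma eta_coeff_bounded:
  "\<exists>A l. A \<ge> 0 \<and> (\<forall>m. norm (eta_coeff m s) \<le> A * real (m + 1) ^ l / 2 ^ m)"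
proof -
  have *: "\<exists>A l. A \<ge> 0 \<and> (\<forall>m. norm (eta_coeff m s) \<le> A * real (m + 1) ^ l / 2 ^ m)"
    if "Re s > -1 - real n" for n s
    using that
  proof (induction n arbitrary: s)
    case 0
    then have s: "Re s > -1" by simp
    show ?case
      unfolding eta_coeff_eq_euler_coeff[OF s]
      using norm_euler_coeff_le[OF s] Gamma_real_pos[of "Re s + 1"] s
      by (intro exI[of _ "Gamma (Re s + 1) / norm (Gamma (s + 1))"] exI[of _ 1]) auto
  next
    case (Suc n)
    then have "Re (s + 1) > -1 - real n" by simp
    from Suc.IH[OF this] obtain A l where A: "A \<ge> 0"
      and le: "\<forall>m. norm (eta_coeff m (s + 1)) \<le> A * real (m + 1) ^ l / 2 ^ m"
      by (elim exE conjE)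
    have "norm (eta_coeff m s) \<le> ((1 + 2 ^ l) * A) * real (m + 1) ^ Suc l / 2 ^ m" for m
    proof -
      let ?b = "A * real (m + 1) ^ l / 2 ^ m"
      have "norm (eta_coeff (Suc m) (s + 1)) \<le> A * real (Suc m + 1) ^ l / 2 ^ Suc m"
        using le by blast
      \<comment> \<open>From \<open>m + 2 <= 2 * (m + 1)\<close>, which is where the factor
        \<open>2 ^ l\<close> in the new constant originates.\<close>
      also have "\<dots> \<le> A * (2 * real (m + 1)) ^ l / 2 ^ m"
        using A by (intro frac_le mult_left_mono power_mono) auto
      finally have 2: "norm (eta_coeff (Suc m) (s + 1)) \<le> 2 ^ l * ?b"
        by (simp only: power_mult_distrib times_divide_eq_right mult_ac)
      have "eta_coeff m s = of_nat (m + 1) * (eta_coeff m (s + 1) - eta_coeff (Suc m) (s + 1))"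
        using eta_coeff_diff_1[of m "s + 1"] by simp
      then have "norm (eta_coeff m s) = real (m + 1) * norm (eta_coeff m (s + 1) - eta_coeff (Suc m) (s + 1))"
        by (simp only: norm_mult norm_of_nat)
      also have "\<dots> \<le> real (m + 1) * (?b + 2 ^ l * ?b)"
        using le 2 by (intro mult_left_mono order.trans[OF norm_triangle_ineq4] add_mono) auto
      also have "\<dots> = ((1 + 2 ^ l) * A) * real (m + 1) ^ Suc l / 2 ^ m"
        by (simp add: algebra_simps add_divide_distrib)
      finally show ?thesis .
    qed
    with A show ?case
      by (intro exI[of _ "(1 + 2 ^ l) * A"] exI[of _ "Suc l"]) auto
  qed
  obtain n where "real n > - Re s - 1" using reals_Archimedean2 by blast
  then show ?thesis by (intro *[where n = n]) auto
qed

text \<open>Abel summation: lowering \<open>s0\<close> by one in the coefficients amounts to lowering \<open>s\<close> by one in the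
  binomial sums, up to a boundary term.\<close>
lemma sum_eta_coeff_binom_sum_shift:
  "(\<Sum>m<M. eta_coeff m (s0 - 1) * binom_sum z m s) =
     (\<Sum>m<M. eta_coeff m s0 * binom_sum z m (s - 1)) - of_nat M * eta_coeff M s0 * binom_sum z (M - 1) s"
proof (induction M)
  case (Suc M)
  then show ?case
    by (simp add: binom_sum_diff_1 eta_coeff_diff_1 algebra_simps)
qed simp

text \<open>Induction over unit strips in \<open>s0\<close>: the hypothesis is used at
  \<open>s0 + 1\<close> and \<open>s - 1\<close>, so the argument \<open>s + s0\<close> of the Lerch
  function is preserved. What remains is that the boundary term of the Abel summation
  vanishes.\<close>

lemma eta_series_sums_lerch:
  assumes z: "norm z = 1" "z \<noteq> 1"
  shows "(\<lambda>m. eta_coeff m s0 * binom_sum z m s) sums lerch z (s + s0)"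
proof -
  have *: "(\<lambda>m. eta_coeff m s0 * binom_sum z m s) sums lerch z (s + s0)" if "Re s0 > -1 - real n" for n s0 s
    using that
  proof (induction n arbitrary: s0 s)
    case 0
    then have "Re s0 > -1" by simp
    then show ?case
      using euler_series_sums_lerch[OF z] by (simp add: eta_coeff_eq_euler_coeff)
  next
    case (Suc n)
    define s1 where "s1 = s0 + 1"
    have s1: "Re s1 > -1 - real n" using Suc.prems by (simp add: s1_def)
    have sums: "(\<lambda>m. eta_coeff m s1 * binom_sum z m (s - 1)) sums lerch z (s - 1 + s1)"
      by (rule Suc.IH[OF s1])
    obtain A l where A: "\<forall>m. norm (eta_coeff m s1) \<le> A * real (m + 1) ^ l / 2 ^ m"
      using eta_coeff_bounded[of s1] by (elim exE conjE)
    have "summable (\<lambda>m. (of_nat (m + 1) * eta_coeff m s1) * binom_sum z m s)"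
    proof (rule euler_series_summable_holomorphic(1)[OF z])
      fix m
      have "norm (of_nat (m + 1) * eta_coeff m s1) \<le> real (m + 1) * (A * real (m + 1) ^ l / 2 ^ m)"
        unfolding norm_mult norm_of_nat using A by (intro mult_left_mono) auto
      then show "norm (of_nat (m + 1) * eta_coeff m s1) \<le> A * real (m + 1) ^ Suc l / 2 ^ m"
        by (simp only: power_Suc times_divide_eq_right mult_ac)
    qed
    \<comment> \<open>By \<open>binom_sum_diff_1\<close> the boundary term is the difference of the
      general terms of two convergent series.\<close>
    from tendsto_diff[OF summable_LIMSEQ_zero[OF this] summable_LIMSEQ_zero[OF sums_summable[OF sums]]]
    have lim: "(\<lambda>M. of_nat M * eta_coeff M s1 * binom_sum z (M - 1) s) \<longlonglongrightarrow> 0"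
      by (simp add: binom_sum_diff_1 algebra_simps)
    have "(\<lambda>M. (\<Sum>m<M. eta_coeff m s1 * binom_sum z m (s - 1)) - of_nat M * eta_coeff M s1 * binom_sum z (M - 1) s)
        \<longlonglongrightarrow> lerch z (s - 1 + s1) - 0"
      using sums unfolding sums_def by (intro tendsto_diff lim)
    then show ?case
      unfolding sum_eta_coeff_binom_sum_shift[symmetric] by (simp add: sums_def s1_def algebra_simps)
  qed
  obtain n where "real n > - Re s0 - 1" using reals_Archimedean2 by blast
  then show ?thesis by (intro *[where n = n]) auto
qed

subsection \<open>Characters as combinations of roots of unity\<close>

definition root_of_unity :: "nat \<Rightarrow> nat \<Rightarrow> complex" where
  "root_of_unity q k = exp (2 * of_real pi * \<i> * of_nat k / of_nat q)"

lemma root_of_unity_power: "root_of_unity q k ^ n = root_of_unity q (k * n)"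
  by (simp add: root_of_unity_def exp_of_nat_mult[symmetric] mult_ac)

lemma norm_root_of_unity: "norm (root_of_unity q k) = 1"
  by (simp add: root_of_unity_def norm_exp_eq_Re)

lemma root_of_unity_neq_1: "0 < k \<Longrightarrow> k < q \<Longrightarrow> root_of_unity q k \<noteq> 1"
  using complex_root_unity_eq_1[of q k] by (auto simp: root_of_unity_def dest: dvd_imp_le)

lemma root_of_unity_orthogonality:
  assumes "q > 0"
  shows "(\<Sum>k<q. (root_of_unity q n / root_of_unity q a) ^ k) = (if n mod q = a mod q then of_nat q else 0)"
proof -
  define x where "x = root_of_unity q n / root_of_unity q a"
  have nz: "root_of_unity q a \<noteq> 0" by (simp add: root_of_unity_def)
  have x1: "x = 1 \<longleftrightarrow> n mod q = a mod q"
    using complex_root_unity_eq[of q n a] assms nz by (simp add: x_def root_of_unity_def)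
  show ?thesis
  proof (cases "x = 1")
    case True
    then show ?thesis using x1 by (simp flip: x_def)
  next
    case False
    have "root_of_unity q b ^ q = 1" for b
      using complex_root_unity_eq_1[of q "b * q"] assms
      unfolding root_of_unity_power by (simp add: root_of_unity_def)
    then have "x ^ q = 1" by (simp add: x_def power_divide)
    then show ?thesis
      using False x1 by (simp add: sum_gp_strict flip: x_def)
  qed
qed

lemma periodic_mod:
  fixes f :: "nat \<Rightarrow> 'a"
  assumes "\<And>n. f (n + q) = f n"
  shows "f (n mod q) = f n"
proof -
  have "f (r + q * t) = f r" for r t
  proof (induction t)
    case (Suc t)
    then show ?case using assms[of "r + q * t"] by (simp add: algebra_simps)
  qed simp
  from this[of "n mod q" "n div q"] show ?thesis by simp
qed

text \<open>Finite Fourier inversion. The vanishing sum over a period removes the frequency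
  \<open>k = 0\<close>, so only roots of unity different from 1 occur.\<close>

lemma periodic_zero_sum_expansion:
  fixes f :: "nat \<Rightarrow> complex"
  assumes q: "q > 0" and per: "\<And>n. f (n + q) = f n" and zero: "(\<Sum>a<q. f a) = 0"
  obtains g where "\<And>n. f n = (\<Sum>k\<in>{1..<q}. g k * root_of_unity q k ^ n)"
proof -
  define g where "g = (\<lambda>k. (\<Sum>a<q. f a / root_of_unity q (k * a)) / of_nat q)"
  have "f n = (\<Sum>k\<in>{1..<q}. g k * root_of_unity q k ^ n)" for n
  proof -
    have g0: "g 0 = 0" by (simp add: g_def root_of_unity_def zero)
    have "(\<Sum>k\<in>{1..<q}. g k * root_of_unity q k ^ n) = (\<Sum>k<q. g k * root_of_unity q k ^ n)"
      by (rule sum.mono_neutral_left) (auto simp: g0 not_less_eq_eq)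
    also have "\<dots> = (\<Sum>k<q. \<Sum>a<q. f a / of_nat q * (root_of_unity q n / root_of_unity q a) ^ k)"
      by (simp add: g_def sum_divide_distrib sum_distrib_left power_divide root_of_unity_power mult_ac)
    also have "\<dots> = (\<Sum>a<q. f a / of_nat q * (\<Sum>k<q. (root_of_unity q n / root_of_unity q a) ^ k))"
      by (subst sum.swap) (simp only: sum_distrib_left)
    also have "\<dots> = (\<Sum>a<q. if a = n mod q then f a else 0)"
      unfolding root_of_unity_orthogonality[OF q] using q by (intro sum.cong refl) auto
    also have "\<dots> = f (n mod q)"
      using q by (subst sum.delta) auto
    also have "\<dots> = f n"
      by (rule periodic_mod[of f, OF per])
    finally show ?thesis ..
  qed
  then show ?thesis by (rule that)
qed

text \<open>Multiplication by \<open>b\<close> permutes the residues modulo \<open>q\<close>, so the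
  sum equals \<open>chi b\<close> times itself with \<open>chi b\<close> different from 1.\<close>

lemma sum_nontrivial_character:
  assumes "nontrivial_character q chi"
  shows "(\<Sum>a<q. chi a) = 0"
proof -
  from assms have q: "q \<ge> 1" and mult: "\<And>m n. chi (m * n) = chi m * chi n" and per: "\<And>n. chi (n + q) = chi n"
    by (auto simp: nontrivial_character_def dirichlet_character_def)
  from assms obtain b where b: "coprime b q" "chi b \<noteq> 1"
    by (auto simp: nontrivial_character_def)
  have "inj_on (\<lambda>a. b * a mod q) {..<q}"
  proof (rule inj_onI)
    fix x y assume "x \<in> {..<q}" "y \<in> {..<q}" "b * x mod q = b * y mod q"
    then have "[x = y] (mod q)"
      using cong_mult_lcancel_nat[OF b(1), of x y] by (simp add: cong_def)
    then show "x = y" using \<open>x \<in> {..<q}\<close> \<open>y \<in> {..<q}\<close> by (simp add: cong_def)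
  qed
  moreover have "(\<lambda>a. b * a mod q) ` {..<q} \<subseteq> {..<q}" using q by auto
  ultimately have "bij_betw (\<lambda>a. b * a mod q) {..<q} {..<q}"
    by (simp add: bij_betw_def endo_inj_surj)
  then have "(\<Sum>a<q. chi a) = (\<Sum>a<q. chi (b * a mod q))"
    by (rule sum.reindex_bij_betw[symmetric])
  also have "\<dots> = chi b * (\<Sum>a<q. chi a)"
    by (simp add: periodic_mod[of chi, OF per] mult sum_distrib_left)
  finally have "(1 - chi b) * (\<Sum>a<q. chi a) = 0" by (simp add: algebra_simps)
  with b(2) show ?thesis by simp
qed

section \<open>Passage from the Lerch function to the L-function\<close>

lemma dirichlet_L_eqI:
  assumes "F holomorphic_on UNIV"
    and sums: "\<And>s. Re s > 1 \<Longrightarrow> (\<lambda>n. chi (Suc n) / of_nat (Suc n) powr s) sums F s"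
  shows "dirichlet_L chi = F"
  unfolding dirichlet_L_def
proof (rule the_equality)
  show "F holomorphic_on UNIV \<and> (\<forall>s. 1 < Re s \<longrightarrow> (\<lambda>n. chi (Suc n) / of_nat (Suc n) powr s) sums F s)"
    using assms by blast
  fix f assume f: "f holomorphic_on UNIV \<and>
      (\<forall>s. 1 < Re s \<longrightarrow> (\<lambda>n. chi (Suc n) / of_nat (Suc n) powr s) sums f s)"
  show "f = F"
  proof (rule holomorphic_eq_if_eq_on_halfplane)
    show "f s = F s" if "Re s > 1" for s
      using f sums[OF that] that sums_unique2 by blast
  qed (use f assms(1) in auto)
qed

theorem theorem6:
  fixes q :: nat and chi :: "nat \<Rightarrow> complex"
  assumes "nontrivial_character q chi"
  shows "(\<forall>s0 s. Re s0 > -1 \<longrightarrow>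
           (\<forall>m::nat. (\<lambda>x::real. of_real x powr s0 * of_real (exp (- x * real (m + 1)))
                 / of_real ((1 + exp (- x)) ^ (m + 2))) integrable_on {0<..}) \<and>
           (\<lambda>m. (1 / Gamma (s0 + 1)) * of_nat (m + 1) *
              integral {0<..} (\<lambda>x::real. of_real x powr s0 * of_real (exp (- x * real (m + 1)))
                 / of_real ((1 + exp (- x)) ^ (m + 2))) *
              (\<Sum>j=0..m. chi (j + 1) * of_nat (m choose j) / of_nat (j + 1) powr s))
             sums dirichlet_L chi (s + s0))
       \<and> (\<forall>s0 s.
           (\<lambda>m. ((-1) ^ m / fact m) *
              (\<Sum>l=1..m+1. of_int (signed_stirling (m + 1) l) * dirichlet_eta (s0 + 1 - of_nat l)) *
              (\<Sum>j=0..m. chi (j + 1) * of_nat (m choose j) / of_nat (j + 1) powr s))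
             sums dirichlet_L chi (s + s0))"
proof -
  have q: "q > 0" and per: "\<And>n. chi (n + q) = chi n"
    using assms by (auto simp: nontrivial_character_def dirichlet_character_def)
  obtain g where g: "\<And>n. chi n = (\<Sum>k\<in>{1..<q}. g k * root_of_unity q k ^ n)"
    using periodic_zero_sum_expansion[OF q per sum_nontrivial_character[OF assms]] by metis
  define w where "w = root_of_unity q"
  \<comment> \<open>The extra factor \<open>w k\<close> absorbs the offset between
    \<open>chi (j + 1)\<close> and the power \<open>w k ^ j\<close>.\<close>
  define h where "h = (\<lambda>k. g k * w k)"
  have chi: "chi (j + 1) = (\<Sum>k\<in>{1..<q}. h k * w k ^ j)" for j
    by (simp add: g h_def w_def mult_ac)
  have w: "norm (w k) = 1" "w k \<noteq> 1" if "k \<in> {1..<q}" for k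
    using that by (auto simp: w_def norm_root_of_unity root_of_unity_neq_1)
  have L: "dirichlet_L chi = (\<lambda>s. \<Sum>k\<in>{1..<q}. h k * lerch (w k) s)"
  proof (rule dirichlet_L_eqI)
    show "(\<lambda>s. \<Sum>k\<in>{1..<q}. h k * lerch (w k) s) holomorphic_on UNIV"
      by (intro holomorphic_intros lerch_holomorphic w)
    fix s :: complex assume "Re s > 1"
    then have "(\<lambda>n. \<Sum>k\<in>{1..<q}. h k * (w k ^ n / of_nat (n + 1) powr s)) sums (\<Sum>k\<in>{1..<q}. h k * lerch (w k) s)"
      by (intro sums_sum sums_mult lerch_sums w) auto
    moreover have "(\<Sum>k\<in>{1..<q}. h k * (w k ^ n / of_nat (n + 1) powr s)) = chi (Suc n) / of_nat (Suc n) powr s" for n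
      using chi[of n] by (simp add: sum_divide_distrib)
    ultimately show "(\<lambda>n. chi (Suc n) / of_nat (Suc n) powr s) sums (\<Sum>k\<in>{1..<q}. h k * lerch (w k) s)"
      by simp
  qed
  have chi_sum: "(\<Sum>j=0..m. chi (j + 1) * of_nat (m choose j) / of_nat (j + 1) powr s) =
      (\<Sum>k\<in>{1..<q}. h k * binom_sum (w k) m s)" for m s
  proof -
    have "(\<Sum>j=0..m. chi (j + 1) * of_nat (m choose j) / of_nat (j + 1) powr s) =
       (\<Sum>j=0..m. \<Sum>k\<in>{1..<q}. h k * (w k ^ j * of_nat (m choose j) / of_nat (j + 1) powr s))"
      unfolding chi by (simp only: sum_distrib_right sum_divide_distrib times_divide_eq_right mult.assoc)
    also have "\<dots> = (\<Sum>k\<in>{1..<q}. h k * binom_sum (w k) m s)"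
      unfolding binom_sum_def sum_distrib_left by (rule sum.swap)
    finally show ?thesis .
  qed
  \<comment> \<open>Both formulas are linear in the character, so arbitrary coefficients
    \<open>c\<close> cover the integral and the Stirling version at once.\<close>
  have linear: "(\<lambda>m. c m * (\<Sum>j=0..m. chi (j + 1) * of_nat (m choose j) / of_nat (j + 1) powr s))
      sums dirichlet_L chi (s + s0)"
    if "\<And>k. k \<in> {1..<q} \<Longrightarrow> (\<lambda>m. c m * binom_sum (w k) m s) sums lerch (w k) (s + s0)" for c s s0
  proof -
    have "(\<lambda>m. \<Sum>k\<in>{1..<q}. h k * (c m * binom_sum (w k) m s)) sums (\<Sum>k\<in>{1..<q}. h k * lerch (w k) (s + s0))"
      by (intro sums_sum sums_mult that)
    then show ?thesis
      unfolding chi_sum L by (simp only: sum_distrib_left mult_ac)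
  qed
  show ?thesis
  proof (intro conjI allI impI)
    fix s0 :: complex and m :: nat assume "Re s0 > -1"
    then show "(\<lambda>x::real. of_real x powr s0 * of_real (exp (- x * real (m + 1)))
                 / of_real ((1 + exp (- x)) ^ (m + 2))) integrable_on {0<..}"
      using integrable_euler_weight[of s0 m] by (simp add: euler_weight_def)
  next
    fix s0 s :: complex assume "Re s0 > -1"
    then show "(\<lambda>m. (1 / Gamma (s0 + 1)) * of_nat (m + 1) *
              integral {0<..} (\<lambda>x::real. of_real x powr s0 * of_real (exp (- x * real (m + 1)))
                 / of_real ((1 + exp (- x)) ^ (m + 2))) *
              (\<Sum>j=0..m. chi (j + 1) * of_nat (m choose j) / of_nat (j + 1) powr s))
             sums dirichlet_L chi (s + s0)"
      unfolding euler_coeff_def[symmetric] by (intro linear euler_series_sums_lerch w)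
  next
    fix s0 s :: complex
    show "(\<lambda>m. ((-1) ^ m / fact m) *
              (\<Sum>l=1..m+1. of_int (signed_stirling (m + 1) l) * dirichlet_eta (s0 + 1 - of_nat l)) *
              (\<Sum>j=0..m. chi (j + 1) * of_nat (m choose j) / of_nat (j + 1) powr s))
             sums dirichlet_L chi (s + s0)"
      unfolding eta_coeff_def[symmetric] by (intro linear eta_series_sums_lerch w)
  qed
qed

end
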